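(* Let $\mathcal{Q}$ be a small quantaloid, $\phi$ a $\mathcal{Q}$-distributor from $\mathbb{A}$ to $\mathbb{B}$, and $\mathbb{A}'\subseteq\mathbb{A}$, $\mathbb{B}'\subseteq\mathbb{B}$ $\mathcal{Q}$-subcategories. Then $\phi_{\mathbb{A}',\mathbb{B}'}$ is a reduct of $\phi$ if and only if $\mathbb{A}\setminus\mathbb{A}'$ and $\mathbb{B}\setminus\mathbb{B}'$ are both $\phi$-reducible.
   Context: A quantaloid is a category whose hom-sets are complete lattices and whose composition preserves arbitrary joins in each variable. For arrows $f:X\to Y$, $g:Y\to Z$, $h:X\to Z$ the implications $h\swarrow f:Y\to Z$ and $g\searrow h:X\to Y$ are determined by $g\circ f\leq h\iff g\leq h\swarrow f\iff f\leq g\searrow h$. A $\mathcal{Q}$-category $\mathbb{A}$ is a set $\mathbb{A}_0$ with a type map $t:\mathbb{A}_0\to\mathrm{ob}\,\mathcal{Q}$ and hom-arrows $\mathbb{A}(x,y)\in\mathcal{Q}(tx,ty)$ with $1_{tx}\leq\mathbb{A}(x,x)$ and $\mathbb{A}(y,z)\circ\mathbb{A}(x,y)\leq\mathbb{A}(x,z)$. Its underlying preorder is: $x\leq y$ iff $tx=ty$ and $1_{tx}\leq\mathbb{A}(x,y)$; $\mathbb{A}$ is skeletal if this is a partial order. A $\mathcal{Q}$-subcategory $\mathbb{A}'\subseteq\mathbb{A}$ is given by a subset of objects with the inherited hom-arrows; $\mathbb{A}\setminus\mathbb{A}'$ is the complementary $\mathcal{Q}$-subcategory. A $\mathcal{Q}$-functor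 $F:\mathbb{A}\to\mathbb{B}$ is a type-preserving map with $\mathbb{A}(x,y)\leq\mathbb{B}(Fx,Fy)$; $\mathcal{Q}$-functors are ordered pointwise, giving the locally ordered 2-category $\mathcal{Q}\text{-}\mathbf{Cat}$, in which adjunctions are taken. A $\mathcal{Q}$-distributor $\phi$ from $\mathbb{A}$ to $\mathbb{B}$ assigns to each $(x,y)\in\mathbb{A}_0\times\mathbb{B}_0$ an arrow $\phi(x,y)\in\mathcal{Q}(tx,ty)$ with $\mathbb{B}(y,y')\circ\phi(x,y)\circ\mathbb{A}(x',x)\leq\phi(x',y')$. With $(\psi\circ\phi)(x,z)=\bigvee_{y}\psi(y,z)\circ\phi(x,y)$, identities $\mathbb{A}$ and the pointwise order, these form a quantaloid $\mathcal{Q}\text{-}\mathbf{Dist}$. A $\mathcal{Q}$-functor $F:\mathbb{A}\to\mathbb{B}$ induces its graph $F_{\natural}(x,y)=\mathbb{B}(Fx,y)$ (from $\mathbb{A}$ to $\mathbb{B}$) and cograph $F^{\natural}(y,x)=\mathbb{B}(y,Fx)$ (from $\mathbb{B}$ to $\mathbb{A}$). A Chu connection from $\phi$ (from $\mathbb{A}$ to $\mathbb{B}$) to $\psi$ (from $\mathbb{C}$ to $\mathbb{D}$) is a pair of $\mathcal{Q}$-distributors $(\zeta,\eta)$, $\zeta$ from $\mathbb{A}$ to $\mathbb{C}$ and $\eta$ from $\mathbb{B}$ to $\mathbb{D}$, with $\phi\swarrow\zeta=\eta\searrow\psi$. For $X\in\mathrm{ob}\,\mathcal{Q}$, $*_X$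 is the $\mathcal{Q}$-category with one object, of type $X$, and hom-arrow $1_X$. $\mathcal{P}\mathbb{A}$ has as objects of type $X$ the $\mathcal{Q}$-distributors $\mu$ from $\mathbb{A}$ to $*_X$, with $\mathcal{P}\mathbb{A}(\mu,\mu')=\mu'\swarrow\mu$; $\mathcal{P}^{\dagger}\mathbb{A}$ has as objects of type $X$ the $\mathcal{Q}$-distributors $\lambda$ from $*_X$ to $\mathbb{A}$, with $\mathcal{P}^{\dagger}\mathbb{A}(\lambda,\lambda')=\lambda'\searrow\lambda$. Each $\phi$ from $\mathbb{A}$ to $\mathbb{B}$ induces an adjunction $\phi_{\uparrow}\dashv\phi^{\downarrow}$ with $\phi_{\uparrow}:\mathcal{P}\mathbb{A}\to\mathcal{P}^{\dagger}\mathbb{B}$, $\mu\mapsto\phi\swarrow\mu$, and $\phi^{\downarrow}:\mathcal{P}^{\dagger}\mathbb{B}\to\mathcal{P}\mathbb{A}$, $\lambda\mapsto\lambda\searrow\phi$. $\mathcal{M}\phi$ is the full $\mathcal{Q}$-subcategory of $\mathcal{P}\mathbb{A}$ on those $\mu$ with $\phi^{\downarrow}\phi_{\uparrow}\mu=\mu$ (it is skeletal and complete). A Chu connection $(\zeta,\eta):\phi\to\psi$ induces a left adjoint $\mathcal{Q}$-functor $\mathcal{M}(\zeta,\eta):\mathcal{M}\psi\to\mathcal{M}\phi$, $\mu'\mapsto\phi^{\downarrow}\phi_{\uparrow}(\mu'\circ\zeta)$. Let $I:\mathbb{A}'\to\mathbb{A}$ and $J:\mathbb{B}'\to\mathbb{B}$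 be the inclusions and let $\phi_{\mathbb{A}',\mathbb{B}'}$ denote the restriction of $\phi$ to $\mathbb{A}'$ and $\mathbb{B}'$ (similarly $\phi_{\mathbb{A}',\mathbb{B}}$, $\phi_{\mathbb{A},\mathbb{B}'}$). Then $(\mathbb{A},J_{\natural}):\phi_{\mathbb{A},\mathbb{B}'}\to\phi$, $(I^{\natural},\mathbb{B}):\phi\to\phi_{\mathbb{A}',\mathbb{B}}$, $(\mathbb{A}',J_{\natural}):\phi_{\mathbb{A}',\mathbb{B}'}\to\phi_{\mathbb{A}',\mathbb{B}}$ and $(I^{\natural},\mathbb{B}'):\phi_{\mathbb{A},\mathbb{B}'}\to\phi_{\mathbb{A}',\mathbb{B}'}$ are Chu connections, inducing left adjoint $\mathcal{Q}$-functors under $\mathcal{M}$. The comparison $\mathcal{Q}$-functors $R_1,R_2:\mathcal{M}\phi\to\mathcal{M}\phi_{\mathbb{A}',\mathbb{B}'}$ and $E_1,E_2:\mathcal{M}\phi_{\mathbb{A}',\mathbb{B}'}\to\mathcal{M}\phi$ are: - $R_1$: the right adjoint of $\mathcal{M}(I^{\natural},\mathbb{B})$ followed by $\mathcal{M}(\mathbb{A}',J_{\natural})$; - $R_2$: $\mathcal{M}(\mathbb{A},J_{\natural})$ followed by the right adjoint of $\mathcal{M}(I^{\natural},\mathbb{B}')$; - $E_1$: the right adjoint of $\mathcal{M}(\mathbb{A}',J_{\natural})$ followed by $\mathcal{M}(I^{\natural},\mathbb{B})$; - $E_2$: $\mathcal{M}(I^{\natural},\mathbb{B}')$ followed by the right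 adjoint of $\mathcal{M}(\mathbb{A},J_{\natural})$. $\phi_{\mathbb{A}',\mathbb{B}'}$ is a reduct of $\phi$ if one (equivalently, each) of $R_1,R_2,E_1,E_2$ is an isomorphism in $\mathcal{Q}\text{-}\mathbf{Cat}$ (it is known that if one of them is an isomorphism then all are). $\mathbb{A}\setminus\mathbb{A}'$ is $\phi$-reducible if for any $\mu\in\mathcal{P}\mathbb{A}$ there exists $\mu'\in\mathcal{P}\mathbb{A}'$ with $\phi\swarrow\mu=\phi_{\mathbb{A}',\mathbb{B}}\swarrow\mu'$. $\mathbb{B}\setminus\mathbb{B}'$ is $\phi$-reducible if for any $\lambda\in\mathcal{P}^{\dagger}\mathbb{B}$ there exists $\lambda'\in\mathcal{P}^{\dagger}\mathbb{B}'$ with $\lambda\searrow\phi=\lambda'\searrow\phi_{\mathbb{A},\mathbb{B}'}$. *)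

theory Defs
  imports "HOL-Algebra.Complete_Lattice" "HOL-Library.FuncSet"
begin

text \<open>
  Arrows of all hom-sets live in one type. Hom-sets are not required to be disjoint, so every
  notion below that depends on the domain or codomain of an arrow takes these objects as
  explicit arguments.
\<close>

record ('o, 'm) quantaloid =
  Ob :: "'o set"
  Hom :: "'o \<Rightarrow> 'o \<Rightarrow> 'm set"
  ident :: "'o \<Rightarrow> 'm"
  cmp :: "'m \<Rightarrow> 'm \<Rightarrow> 'm"  (infixl \<open>\<circ>\<circ>\<index>\<close> 70)
  leq :: "'m \<Rightarrow> 'm \<Rightarrow> bool"  (infix \<open>\<preceq>\<index>\<close> 50)

definition hom_poset :: "('o, 'm) quantaloid \<Rightarrow> 'o \<Rightarrow> 'o \<Rightarrow> 'm gorder" where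
  "hom_poset Q X Y = \<lparr>carrier = Hom Q X Y, eq = (=), le = leq Q\<rparr>"

definition Join :: "('o, 'm) quantaloid \<Rightarrow> 'o \<Rightarrow> 'o \<Rightarrow> 'm set \<Rightarrow> 'm" where
  "Join Q X Y S = \<Squnion>\<^bsub>hom_poset Q X Y\<^esub> S"

locale quantaloid =
  fixes Q :: "('o, 'm) quantaloid" (structure)
  assumes ident_in: "X \<in> Ob Q \<Longrightarrow> ident Q X \<in> Hom Q X X"
    and cmp_in:
      "\<lbrakk>X \<in> Ob Q; Y \<in> Ob Q; Z \<in> Ob Q; f \<in> Hom Q X Y; g \<in> Hom Q Y Z\<rbrakk> \<Longrightarrow> g \<circ>\<circ> f \<in> Hom Q X Z"
    and ident_left: "\<lbrakk>X \<in> Ob Q; Y \<in> Ob Q; f \<in> Hom Q X Y\<rbrakk> \<Longrightarrow> ident Q Y \<circ>\<circ> f = f"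
    and ident_right: "\<lbrakk>X \<in> Ob Q; Y \<in> Ob Q; f \<in> Hom Q X Y\<rbrakk> \<Longrightarrow> f \<circ>\<circ> ident Q X = f"
    and cmp_assoc:
      "\<lbrakk>W \<in> Ob Q; X \<in> Ob Q; Y \<in> Ob Q; Z \<in> Ob Q;
        f \<in> Hom Q W X; g \<in> Hom Q X Y; h \<in> Hom Q Y Z\<rbrakk>
       \<Longrightarrow> h \<circ>\<circ> (g \<circ>\<circ> f) = (h \<circ>\<circ> g) \<circ>\<circ> f"
    and hom_complete:
      "\<lbrakk>X \<in> Ob Q; Y \<in> Ob Q\<rbrakk> \<Longrightarrow> complete_lattice (hom_poset Q X Y)"
    and cmp_Join_left:
      "\<lbrakk>X \<in> Ob Q; Y \<in> Ob Q; Z \<in> Ob Q; f \<in> Hom Q X Y; S \<subseteq> Hom Q Y Z\<rbrakk>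
       \<Longrightarrow> Join Q Y Z S \<circ>\<circ> f = Join Q X Z {g \<circ>\<circ> f | g. g \<in> S}"
    and cmp_Join_right:
      "\<lbrakk>X \<in> Ob Q; Y \<in> Ob Q; Z \<in> Ob Q; S \<subseteq> Hom Q X Y; g \<in> Hom Q Y Z\<rbrakk>
       \<Longrightarrow> g \<circ>\<circ> Join Q X Y S = Join Q X Z {g \<circ>\<circ> f | f. f \<in> S}"

record ('x, 'o, 'm) qcat =
  Obj :: "'x set"
  tp :: "'x \<Rightarrow> 'o"
  hm :: "'x \<Rightarrow> 'x \<Rightarrow> 'm"

definition qcategory :: "('o, 'm) quantaloid \<Rightarrow> ('x, 'o, 'm) qcat \<Rightarrow> bool" where
  "qcategory Q A \<longleftrightarrow>
     (\<forall>x \<in> Obj A. tp A x \<in> Ob Q) \<and>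
     (\<forall>x \<in> Obj A. \<forall>y \<in> Obj A. hm A x y \<in> Hom Q (tp A x) (tp A y)) \<and>
     (\<forall>x \<in> Obj A. ident Q (tp A x) \<preceq>\<^bsub>Q\<^esub> hm A x x) \<and>
     (\<forall>x \<in> Obj A. \<forall>y \<in> Obj A. \<forall>z \<in> Obj A. hm A y z \<circ>\<circ>\<^bsub>Q\<^esub> hm A x y \<preceq>\<^bsub>Q\<^esub> hm A x z)"

definition underlying_le ::
    "('o, 'm) quantaloid \<Rightarrow> ('x, 'o, 'm) qcat \<Rightarrow> 'x \<Rightarrow> 'x \<Rightarrow> bool" where
  "underlying_le Q A x y \<longleftrightarrow> tp A x = tp A y \<and> ident Q (tp A x) \<preceq>\<^bsub>Q\<^esub> hm A x y"

definition subcat :: "('x, 'o, 'm) qcat \<Rightarrow> 'x set \<Rightarrow> ('x, 'o, 'm) qcat" where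
  "subcat A S = \<lparr>Obj = S, tp = tp A, hm = hm A\<rparr>"

text \<open>
  Functors and distributors are required to be \<open>undefined\<close> outside their domain, so that
  HOL equality is equality of functors and of distributors.
\<close>

definition qfunctor ::
    "('o, 'm) quantaloid \<Rightarrow> ('x, 'o, 'm) qcat \<Rightarrow> ('y, 'o, 'm) qcat \<Rightarrow> ('x \<Rightarrow> 'y) \<Rightarrow> bool" where
  "qfunctor Q A B F \<longleftrightarrow>
     F \<in> Obj A \<rightarrow>\<^sub>E Obj B \<and>
     (\<forall>x \<in> Obj A. tp B (F x) = tp A x) \<and>
     (\<forall>x \<in> Obj A. \<forall>y \<in> Obj A. hm A x y \<preceq>\<^bsub>Q\<^esub> hm B (F x) (F y))"

definition id_functor :: "('x, 'o, 'm) qcat \<Rightarrow> 'x \<Rightarrow> 'x" where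
  "id_functor A = (\<lambda>x \<in> Obj A. x)"

definition functor_le ::
    "('o, 'm) quantaloid \<Rightarrow> ('x, 'o, 'm) qcat \<Rightarrow> ('y, 'o, 'm) qcat
      \<Rightarrow> ('x \<Rightarrow> 'y) \<Rightarrow> ('x \<Rightarrow> 'y) \<Rightarrow> bool" where
  "functor_le Q A B F G \<longleftrightarrow> (\<forall>x \<in> Obj A. underlying_le Q B (F x) (G x))"

text \<open>\<open>F : A \<rightarrow> B\<close> is left adjoint to \<open>G : B \<rightarrow> A\<close>.\<close>

definition adjunction ::
    "('o, 'm) quantaloid \<Rightarrow> ('x, 'o, 'm) qcat \<Rightarrow> ('y, 'o, 'm) qcat
      \<Rightarrow> ('x \<Rightarrow> 'y) \<Rightarrow> ('y \<Rightarrow> 'x) \<Rightarrow> bool" where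
  "adjunction Q A B F G \<longleftrightarrow>
     qfunctor Q A B F \<and> qfunctor Q B A G \<and>
     functor_le Q A A (id_functor A) (compose (Obj A) G F) \<and>
     functor_le Q B B (compose (Obj B) F G) (id_functor B)"

text \<open>
  Only used when \<open>A\<close> is skeletal and \<open>F\<close> is a left adjoint; then there is exactly one such \<open>G\<close>.
\<close>

definition right_adjoint ::
    "('o, 'm) quantaloid \<Rightarrow> ('x, 'o, 'm) qcat \<Rightarrow> ('y, 'o, 'm) qcat \<Rightarrow> ('x \<Rightarrow> 'y) \<Rightarrow> ('y \<Rightarrow> 'x)" where
  "right_adjoint Q A B F = (THE G. adjunction Q A B F G)"

definition isomorphism ::
    "('o, 'm) quantaloid \<Rightarrow> ('x, 'o, 'm) qcat \<Rightarrow> ('y, 'o, 'm) qcat \<Rightarrow> ('x \<Rightarrow> 'y) \<Rightarrow> bool" where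
  "isomorphism Q A B F \<longleftrightarrow>
     qfunctor Q A B F \<and>
     (\<exists>G. qfunctor Q B A G \<and>
          compose (Obj A) G F = id_functor A \<and> compose (Obj B) F G = id_functor B)"

definition distributor ::
    "('o, 'm) quantaloid \<Rightarrow> ('x, 'o, 'm) qcat \<Rightarrow> ('y, 'o, 'm) qcat \<Rightarrow> ('x \<times> 'y \<Rightarrow> 'm) \<Rightarrow> bool" where
  "distributor Q A B \<phi> \<longleftrightarrow>
     \<phi> \<in> extensional (Obj A \<times> Obj B) \<and>
     (\<forall>x \<in> Obj A. \<forall>y \<in> Obj B. \<phi> (x, y) \<in> Hom Q (tp A x) (tp B y)) \<and>
     (\<forall>x \<in> Obj A. \<forall>x' \<in> Obj A. \<forall>y \<in> Obj B. \<forall>y' \<in> Obj B.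
        hm B y y' \<circ>\<circ>\<^bsub>Q\<^esub> \<phi> (x, y) \<circ>\<circ>\<^bsub>Q\<^esub> hm A x' x \<preceq>\<^bsub>Q\<^esub> \<phi> (x', y'))"

definition dist_le ::
    "('o, 'm) quantaloid \<Rightarrow> ('x, 'o, 'm) qcat \<Rightarrow> ('y, 'o, 'm) qcat
      \<Rightarrow> ('x \<times> 'y \<Rightarrow> 'm) \<Rightarrow> ('x \<times> 'y \<Rightarrow> 'm) \<Rightarrow> bool" where
  "dist_le Q A B \<phi> \<psi> \<longleftrightarrow> (\<forall>x \<in> Obj A. \<forall>y \<in> Obj B. \<phi> (x, y) \<preceq>\<^bsub>Q\<^esub> \<psi> (x, y))"

definition id_dist :: "('x, 'o, 'm) qcat \<Rightarrow> ('x \<times> 'x \<Rightarrow> 'm)" where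
  "id_dist A = (\<lambda>(x, y) \<in> Obj A \<times> Obj A. hm A x y)"

text \<open>\<open>dist_comp Q A B C \<psi> \<phi>\<close> is \<open>\<psi> \<circ> \<phi>\<close> for \<open>\<phi>\<close> from \<open>A\<close> to \<open>B\<close> and \<open>\<psi>\<close> from \<open>B\<close> to \<open>C\<close>.\<close>

definition dist_comp ::
    "('o, 'm) quantaloid \<Rightarrow> ('x, 'o, 'm) qcat \<Rightarrow> ('y, 'o, 'm) qcat \<Rightarrow> ('z, 'o, 'm) qcat
      \<Rightarrow> ('y \<times> 'z \<Rightarrow> 'm) \<Rightarrow> ('x \<times> 'y \<Rightarrow> 'm) \<Rightarrow> ('x \<times> 'z \<Rightarrow> 'm)" where
  "dist_comp Q A B C \<psi> \<phi> =
     (\<lambda>(x, z) \<in> Obj A \<times> Obj C.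
        Join Q (tp A x) (tp C z) {\<psi> (y, z) \<circ>\<circ>\<^bsub>Q\<^esub> \<phi> (x, y) | y. y \<in> Obj B})"

text \<open>
  The implications in the quantaloid of distributors, for \<open>f\<close> from \<open>A\<close> to \<open>B\<close>, \<open>g\<close> from \<open>B\<close> to
  \<open>C\<close> and \<open>h\<close> from \<open>A\<close> to \<open>C\<close>: \<open>dist_limp Q A B C h f\<close> is \<open>h \<swarrow> f\<close>, from \<open>B\<close> to \<open>C\<close>, and
  \<open>dist_rimp Q A B C g h\<close> is \<open>g \<searrow> h\<close>, from \<open>A\<close> to \<open>B\<close>. They are given by their defining
  universal property.
\<close>

definition dist_limp ::
    "('o, 'm) quantaloid \<Rightarrow> ('x, 'o, 'm) qcat \<Rightarrow> ('y, 'o, 'm) qcat \<Rightarrow> ('z, 'o, 'm) qcat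
      \<Rightarrow> ('x \<times> 'z \<Rightarrow> 'm) \<Rightarrow> ('x \<times> 'y \<Rightarrow> 'm) \<Rightarrow> ('y \<times> 'z \<Rightarrow> 'm)" where
  "dist_limp Q A B C h f =
     (THE k. distributor Q B C k \<and>
       (\<forall>g. distributor Q B C g \<longrightarrow>
          (dist_le Q A C (dist_comp Q A B C g f) h \<longleftrightarrow> dist_le Q B C g k)))"

definition dist_rimp ::
    "('o, 'm) quantaloid \<Rightarrow> ('x, 'o, 'm) qcat \<Rightarrow> ('y, 'o, 'm) qcat \<Rightarrow> ('z, 'o, 'm) qcat
      \<Rightarrow> ('y \<times> 'z \<Rightarrow> 'm) \<Rightarrow> ('x \<times> 'z \<Rightarrow> 'm) \<Rightarrow> ('x \<times> 'y \<Rightarrow> 'm)" where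
  "dist_rimp Q A B C g h =
     (THE k. distributor Q A B k \<and>
       (\<forall>f. distributor Q A B f \<longrightarrow>
          (dist_le Q A C (dist_comp Q A B C g f) h \<longleftrightarrow> dist_le Q A B f k)))"

definition graph ::
    "('x, 'o, 'm) qcat \<Rightarrow> ('y, 'o, 'm) qcat \<Rightarrow> ('x \<Rightarrow> 'y) \<Rightarrow> ('x \<times> 'y \<Rightarrow> 'm)" where
  "graph A B F = (\<lambda>(x, y) \<in> Obj A \<times> Obj B. hm B (F x) y)"

definition cograph ::
    "('x, 'o, 'm) qcat \<Rightarrow> ('y, 'o, 'm) qcat \<Rightarrow> ('x \<Rightarrow> 'y) \<Rightarrow> ('y \<times> 'x \<Rightarrow> 'm)" where
  "cograph A B F = (\<lambda>(y, x) \<in> Obj B \<times> Obj A. hm B y (F x))"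

definition star :: "('o, 'm) quantaloid \<Rightarrow> 'o \<Rightarrow> (unit, 'o, 'm) qcat" where
  "star Q X = \<lparr>Obj = {()}, tp = (\<lambda>_. X), hm = (\<lambda>_ _. ident Q X)\<rparr>"

text \<open>
  Objects of a presheaf category are paired with their type: over an empty category the
  type cannot be recovered from the distributor.
\<close>

type_synonym ('x, 'o, 'm) presheaf = "'o \<times> ('x \<times> unit \<Rightarrow> 'm)"
type_synonym ('x, 'o, 'm) copresheaf = "'o \<times> (unit \<times> 'x \<Rightarrow> 'm)"

definition Psh ::
    "('o, 'm) quantaloid \<Rightarrow> ('x, 'o, 'm) qcat \<Rightarrow> (('x, 'o, 'm) presheaf, 'o, 'm) qcat" where
  "Psh Q A =
     \<lparr>Obj = {(X, \<mu>). X \<in> Ob Q \<and> distributor Q A (star Q X) \<mu>},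
      tp = fst,
      hm = (\<lambda>(X, \<mu>) (X', \<mu>'). dist_limp Q A (star Q X) (star Q X') \<mu>' \<mu> ((), ()))\<rparr>"

definition coPsh ::
    "('o, 'm) quantaloid \<Rightarrow> ('x, 'o, 'm) qcat \<Rightarrow> (('x, 'o, 'm) copresheaf, 'o, 'm) qcat" where
  "coPsh Q A =
     \<lparr>Obj = {(X, \<kappa>). X \<in> Ob Q \<and> distributor Q (star Q X) A \<kappa>},
      tp = fst,
      hm = (\<lambda>(X, \<kappa>) (X', \<kappa>'). dist_rimp Q (star Q X) (star Q X') A \<kappa>' \<kappa> ((), ()))\<rparr>"

definition up ::
    "('o, 'm) quantaloid \<Rightarrow> ('x, 'o, 'm) qcat \<Rightarrow> ('y, 'o, 'm) qcat \<Rightarrow> ('x \<times> 'y \<Rightarrow> 'm)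
      \<Rightarrow> ('x, 'o, 'm) presheaf \<Rightarrow> ('y, 'o, 'm) copresheaf" where
  "up Q A B \<phi> = (\<lambda>(X, \<mu>) \<in> Obj (Psh Q A). (X, dist_limp Q A (star Q X) B \<phi> \<mu>))"

definition down ::
    "('o, 'm) quantaloid \<Rightarrow> ('x, 'o, 'm) qcat \<Rightarrow> ('y, 'o, 'm) qcat \<Rightarrow> ('x \<times> 'y \<Rightarrow> 'm)
      \<Rightarrow> ('y, 'o, 'm) copresheaf \<Rightarrow> ('x, 'o, 'm) presheaf" where
  "down Q A B \<phi> = (\<lambda>(X, \<kappa>) \<in> Obj (coPsh Q B). (X, dist_rimp Q A (star Q X) B \<kappa> \<phi>))"

definition M_cat ::
    "('o, 'm) quantaloid \<Rightarrow> ('x, 'o, 'm) qcat \<Rightarrow> ('y, 'o, 'm) qcat \<Rightarrow> ('x \<times> 'y \<Rightarrow> 'm)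
      \<Rightarrow> (('x, 'o, 'm) presheaf, 'o, 'm) qcat" where
  "M_cat Q A B \<phi> =
     subcat (Psh Q A) {p \<in> Obj (Psh Q A). down Q A B \<phi> (up Q A B \<phi> p) = p}"

definition chu_connection ::
    "('o, 'm) quantaloid
      \<Rightarrow> ('a, 'o, 'm) qcat \<Rightarrow> ('b, 'o, 'm) qcat \<Rightarrow> ('a \<times> 'b \<Rightarrow> 'm)
      \<Rightarrow> ('c, 'o, 'm) qcat \<Rightarrow> ('d, 'o, 'm) qcat \<Rightarrow> ('c \<times> 'd \<Rightarrow> 'm)
      \<Rightarrow> ('a \<times> 'c \<Rightarrow> 'm) \<times> ('b \<times> 'd \<Rightarrow> 'm) \<Rightarrow> bool" where
  "chu_connection Q A B \<phi> C D \<psi> = (\<lambda>(\<zeta>, \<eta>).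
     distributor Q A C \<zeta> \<and> distributor Q B D \<eta> \<and>
     dist_limp Q A C B \<phi> \<zeta> = dist_rimp Q C B D \<eta> \<psi>)"

text \<open>
  The functor from \<open>M_cat Q C D \<psi>\<close> to \<open>M_cat Q A B \<phi>\<close> induced by a Chu connection
  \<open>(\<zeta>, \<eta>)\<close> from \<open>\<phi>\<close> to \<open>\<psi>\<close>; its value depends on \<open>\<zeta>\<close> only.
\<close>

definition M_map ::
    "('o, 'm) quantaloid
      \<Rightarrow> ('a, 'o, 'm) qcat \<Rightarrow> ('b, 'o, 'm) qcat \<Rightarrow> ('a \<times> 'b \<Rightarrow> 'm)
      \<Rightarrow> ('c, 'o, 'm) qcat \<Rightarrow> ('d, 'o, 'm) qcat \<Rightarrow> ('c \<times> 'd \<Rightarrow> 'm)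
      \<Rightarrow> ('a \<times> 'c \<Rightarrow> 'm) \<times> ('b \<times> 'd \<Rightarrow> 'm)
      \<Rightarrow> ('c, 'o, 'm) presheaf \<Rightarrow> ('a, 'o, 'm) presheaf" where
  "M_map Q A B \<phi> C D \<psi> = (\<lambda>(\<zeta>, \<eta>).
     \<lambda>(X, \<mu>) \<in> Obj (M_cat Q C D \<psi>).
       down Q A B \<phi> (up Q A B \<phi> (X, dist_comp Q A C (star Q X) \<mu> \<zeta>)))"

definition dist_restrict :: "('x \<times> 'y \<Rightarrow> 'm) \<Rightarrow> 'x set \<Rightarrow> 'y set \<Rightarrow> ('x \<times> 'y \<Rightarrow> 'm)" where
  "dist_restrict \<phi> S T = restrict \<phi> (S \<times> T)"

definition incl :: "'x set \<Rightarrow> 'x \<Rightarrow> 'x" where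
  "incl S = (\<lambda>x \<in> S. x)"

text \<open>
  From here on \<open>S\<close> and \<open>T\<close> are the object sets of the subcategories \<open>A' = subcat A S\<close> of \<open>A\<close> and
  \<open>B' = subcat B T\<close> of \<open>B\<close>. The next four functors are induced by the Chu connections
  \<open>(A, J\<^sub>\<natural>) : \<phi>_AB' \<rightarrow> \<phi>\<close>, \<open>(I\<^sup>\<natural>, B) : \<phi> \<rightarrow> \<phi>_A'B\<close>, \<open>(A', J\<^sub>\<natural>) : \<phi>_A'B' \<rightarrow> \<phi>_A'B\<close> and
  \<open>(I\<^sup>\<natural>, B') : \<phi>_AB' \<rightarrow> \<phi>_A'B'\<close>, in this order.
\<close>

definition M_A_J ::
    "('o, 'm) quantaloid \<Rightarrow> ('a, 'o, 'm) qcat \<Rightarrow> ('b, 'o, 'm) qcat \<Rightarrow> ('a \<times> 'b \<Rightarrow> 'm)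
      \<Rightarrow> 'b set \<Rightarrow> ('a, 'o, 'm) presheaf \<Rightarrow> ('a, 'o, 'm) presheaf" where
  "M_A_J Q A B \<phi> T =
     M_map Q A (subcat B T) (dist_restrict \<phi> (Obj A) T) A B \<phi>
       (id_dist A, graph (subcat B T) B (incl T))"

definition M_I_B ::
    "('o, 'm) quantaloid \<Rightarrow> ('a, 'o, 'm) qcat \<Rightarrow> ('b, 'o, 'm) qcat \<Rightarrow> ('a \<times> 'b \<Rightarrow> 'm)
      \<Rightarrow> 'a set \<Rightarrow> ('a, 'o, 'm) presheaf \<Rightarrow> ('a, 'o, 'm) presheaf" where
  "M_I_B Q A B \<phi> S =
     M_map Q A B \<phi> (subcat A S) B (dist_restrict \<phi> S (Obj B))
       (cograph (subcat A S) A (incl S), id_dist B)"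

definition M_A'_J ::
    "('o, 'm) quantaloid \<Rightarrow> ('a, 'o, 'm) qcat \<Rightarrow> ('b, 'o, 'm) qcat \<Rightarrow> ('a \<times> 'b \<Rightarrow> 'm)
      \<Rightarrow> 'a set \<Rightarrow> 'b set \<Rightarrow> ('a, 'o, 'm) presheaf \<Rightarrow> ('a, 'o, 'm) presheaf" where
  "M_A'_J Q A B \<phi> S T =
     M_map Q (subcat A S) (subcat B T) (dist_restrict \<phi> S T)
       (subcat A S) B (dist_restrict \<phi> S (Obj B))
       (id_dist (subcat A S), graph (subcat B T) B (incl T))"

definition M_I_B' ::
    "('o, 'm) quantaloid \<Rightarrow> ('a, 'o, 'm) qcat \<Rightarrow> ('b, 'o, 'm) qcat \<Rightarrow> ('a \<times> 'b \<Rightarrow> 'm)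
      \<Rightarrow> 'a set \<Rightarrow> 'b set \<Rightarrow> ('a, 'o, 'm) presheaf \<Rightarrow> ('a, 'o, 'm) presheaf" where
  "M_I_B' Q A B \<phi> S T =
     M_map Q A (subcat B T) (dist_restrict \<phi> (Obj A) T)
       (subcat A S) (subcat B T) (dist_restrict \<phi> S T)
       (cograph (subcat A S) A (incl S), id_dist (subcat B T))"

definition R1 ::
    "('o, 'm) quantaloid \<Rightarrow> ('a, 'o, 'm) qcat \<Rightarrow> ('b, 'o, 'm) qcat \<Rightarrow> ('a \<times> 'b \<Rightarrow> 'm)
      \<Rightarrow> 'a set \<Rightarrow> 'b set \<Rightarrow> ('a, 'o, 'm) presheaf \<Rightarrow> ('a, 'o, 'm) presheaf" where
  "R1 Q A B \<phi> S T =
     compose (Obj (M_cat Q A B \<phi>))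
       (M_A'_J Q A B \<phi> S T)
       (right_adjoint Q (M_cat Q (subcat A S) B (dist_restrict \<phi> S (Obj B))) (M_cat Q A B \<phi>)
          (M_I_B Q A B \<phi> S))"

definition R2 ::
    "('o, 'm) quantaloid \<Rightarrow> ('a, 'o, 'm) qcat \<Rightarrow> ('b, 'o, 'm) qcat \<Rightarrow> ('a \<times> 'b \<Rightarrow> 'm)
      \<Rightarrow> 'a set \<Rightarrow> 'b set \<Rightarrow> ('a, 'o, 'm) presheaf \<Rightarrow> ('a, 'o, 'm) presheaf" where
  "R2 Q A B \<phi> S T =
     compose (Obj (M_cat Q A B \<phi>))
       (right_adjoint Q
          (M_cat Q (subcat A S) (subcat B T) (dist_restrict \<phi> S T))
          (M_cat Q A (subcat B T) (dist_restrict \<phi> (Obj A) T))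
          (M_I_B' Q A B \<phi> S T))
       (M_A_J Q A B \<phi> T)"

definition E1 ::
    "('o, 'm) quantaloid \<Rightarrow> ('a, 'o, 'm) qcat \<Rightarrow> ('b, 'o, 'm) qcat \<Rightarrow> ('a \<times> 'b \<Rightarrow> 'm)
      \<Rightarrow> 'a set \<Rightarrow> 'b set \<Rightarrow> ('a, 'o, 'm) presheaf \<Rightarrow> ('a, 'o, 'm) presheaf" where
  "E1 Q A B \<phi> S T =
     compose (Obj (M_cat Q (subcat A S) (subcat B T) (dist_restrict \<phi> S T)))
       (M_I_B Q A B \<phi> S)
       (right_adjoint Q
          (M_cat Q (subcat A S) B (dist_restrict \<phi> S (Obj B)))
          (M_cat Q (subcat A S) (subcat B T) (dist_restrict \<phi> S T))
          (M_A'_J Q A B \<phi> S T))"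

definition E2 ::
    "('o, 'm) quantaloid \<Rightarrow> ('a, 'o, 'm) qcat \<Rightarrow> ('b, 'o, 'm) qcat \<Rightarrow> ('a \<times> 'b \<Rightarrow> 'm)
      \<Rightarrow> 'a set \<Rightarrow> 'b set \<Rightarrow> ('a, 'o, 'm) presheaf \<Rightarrow> ('a, 'o, 'm) presheaf" where
  "E2 Q A B \<phi> S T =
     compose (Obj (M_cat Q (subcat A S) (subcat B T) (dist_restrict \<phi> S T)))
       (right_adjoint Q (M_cat Q A B \<phi>) (M_cat Q A (subcat B T) (dist_restrict \<phi> (Obj A) T))
          (M_A_J Q A B \<phi> T))
       (M_I_B' Q A B \<phi> S T)"

text \<open>If one of the four comparison functors is an isomorphism, then all of them are.\<close>

definition is_reduct ::
    "('o, 'm) quantaloid \<Rightarrow> ('a, 'o, 'm) qcat \<Rightarrow> ('b, 'o, 'm) qcat \<Rightarrow> ('a \<times> 'b \<Rightarrow> 'm)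
      \<Rightarrow> 'a set \<Rightarrow> 'b set \<Rightarrow> bool" where
  "is_reduct Q A B \<phi> S T \<longleftrightarrow>
     (let M = M_cat Q A B \<phi>;
          M' = M_cat Q (subcat A S) (subcat B T) (dist_restrict \<phi> S T)
      in isomorphism Q M M' (R1 Q A B \<phi> S T) \<or> isomorphism Q M M' (R2 Q A B \<phi> S T) \<or>
         isomorphism Q M' M (E1 Q A B \<phi> S T) \<or> isomorphism Q M' M (E2 Q A B \<phi> S T))"

text \<open>
  Reducibility of the subcategory on the object set \<open>D\<close>; the presheaves \<open>\<mu>'\<close> and copresheaves
  \<open>\<kappa>'\<close> live on the complementary subcategory. They have the type \<open>X\<close> of the given one, since
  an equality of distributors includes equality of their domains and codomains.
\<close>

definition reducible_dom ::
    "('o, 'm) quantaloid \<Rightarrow> ('a, 'o, 'm) qcat \<Rightarrow> ('b, 'o, 'm) qcat \<Rightarrow> ('a \<times> 'b \<Rightarrow> 'm)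
      \<Rightarrow> 'a set \<Rightarrow> bool" where
  "reducible_dom Q A B \<phi> D \<longleftrightarrow>
     (let S = Obj A - D; A' = subcat A S
      in \<forall>X \<mu>. (X, \<mu>) \<in> Obj (Psh Q A) \<longrightarrow>
           (\<exists>\<mu>'. (X, \<mu>') \<in> Obj (Psh Q A') \<and>
              dist_limp Q A (star Q X) B \<phi> \<mu> =
              dist_limp Q A' (star Q X) B (dist_restrict \<phi> S (Obj B)) \<mu>'))"

definition reducible_cod ::
    "('o, 'm) quantaloid \<Rightarrow> ('a, 'o, 'm) qcat \<Rightarrow> ('b, 'o, 'm) qcat \<Rightarrow> ('a \<times> 'b \<Rightarrow> 'm)
      \<Rightarrow> 'b set \<Rightarrow> bool" where
  "reducible_cod Q A B \<phi> D \<longleftrightarrow>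
     (let T = Obj B - D; B' = subcat B T
      in \<forall>X \<kappa>. (X, \<kappa>) \<in> Obj (coPsh Q B) \<longrightarrow>
           (\<exists>\<kappa>'. (X, \<kappa>') \<in> Obj (coPsh Q B') \<and>
              dist_rimp Q A (star Q X) B \<kappa> \<phi> =
              dist_rimp Q A (star Q X) B' \<kappa>' (dist_restrict \<phi> (Obj A) T)))"

end

theory Submission
  imports Defs
begin

text \<open>
  Write \<open>M\<close>, \<open>M\<^sub>S\<close>, \<open>M\<^sub>T\<close> and \<open>M\<^sub>S\<^sub>T\<close> for the categories of closed presheaves of \<open>\<phi>\<close> and of
  its restrictions to the objects \<open>S\<close> of \<open>A\<close>, to the objects \<open>T\<close> of \<open>B\<close>, and to both. Cutting down
  one side at a time relates them by two elementary adjunctions.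

  \<^item> Shrinking the domain. Restriction to \<open>S\<close> satisfies \<open>(\<kappa> \<searrow> \<phi>)|S = \<kappa> \<searrow> (\<phi>|S)\<close>, hence maps \<open>M\<close> to
    \<open>M\<^sub>S\<close>. It is right adjoint to the functor \<open>L\<close> induced by \<open>(I\<^sup>\<natural>, B)\<close>, which takes \<open>\<mu>\<close> to
    \<open>(\<phi>|S \<swarrow> \<mu>) \<searrow> \<phi>\<close>, and restriction after \<open>L\<close> is the identity of \<open>M\<^sub>S\<close>.
  \<^item> Shrinking the codomain. \<open>M\<^sub>T\<close> is contained in \<open>M\<close>, and the inclusion is right adjoint to the
    functor induced by \<open>(A, J\<^sub>\<natural>)\<close>, which is the closure operator of the restricted distributor.

  The same applies with \<open>\<phi>\<close> replaced by either partial restriction. So, with \<open>L\<^sub>T\<close> from \<open>M\<^sub>S\<^sub>T\<close> to \<open>M\<^sub>T\<close>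
  defined like \<open>L\<close>, \<open>R\<^sub>1\<close> is restriction followed by \<open>ST\<close>-closure, \<open>R\<^sub>2\<close> is \<open>T\<close>-closure followed by
  restriction, \<open>E\<^sub>1\<close> is \<open>L\<close> on \<open>M\<^sub>S\<^sub>T\<close>, and \<open>E\<^sub>2\<close> is \<open>L\<^sub>T\<close>.

  Reducibility translates into this language: the complement of \<open>S\<close> is reducible iff restriction
  to \<open>S\<close> is injective on \<open>M\<close> (lemma \<open>reducible_dom_iff_inj\<close>), and the complement of \<open>T\<close> is reducible
  iff \<open>M\<close> is contained in \<open>M\<^sub>T\<close> (lemma \<open>reducible_cod_iff_subset\<close>). What remains is bookkeeping with maps between sets.
  If both hold, then \<open>M = M\<^sub>T\<close> and the functors \<open>L\<^sub>T\<close> and restriction are mutually inverse, so \<open>E\<^sub>2\<close> is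
  an isomorphism. Conversely, injectivity of \<open>R\<^sub>1\<close> or \<open>R\<^sub>2\<close>, or surjectivity of \<open>E\<^sub>1\<close> or \<open>E\<^sub>2\<close>, gives
  both conditions. For \<open>R\<^sub>1\<close> and \<open>E\<^sub>1\<close> the second condition rests on lemma \<open>M_subset_T_M\<close>: if
  restriction is injective and lands in \<open>M\<^sub>S\<^sub>T\<close>, then each \<open>p\<close> in \<open>M\<close> has the same restriction as
  \<open>L\<^sub>T(p|S)\<close>, hence equals it and lies in \<open>M\<^sub>T\<close>.

  All presheaf computations are pointwise: lemmas \<open>le_dist_limp_iff\<close> and \<open>le_dist_rimp_iff\<close> describe
  the arrows below an entry of an implication by inequalities of composites in the quantaloid.
\<close>

section \<open>Order and composition in a quantaloid\<close>

context quantaloid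
begin

lemma leq_refl: "\<lbrakk>X \<in> Ob Q; Y \<in> Ob Q; f \<in> Hom Q X Y\<rbrakk> \<Longrightarrow> f \<preceq> f"
proof -
  assume *: "X \<in> Ob Q" "Y \<in> Ob Q" "f \<in> Hom Q X Y"
  interpret complete_lattice "hom_poset Q X Y" using * hom_complete by blast
  show ?thesis using * le_refl[of f] by (simp add: hom_poset_def)
qed

lemma leq_antisym:
  assumes "X \<in> Ob Q" "Y \<in> Ob Q" "f \<in> Hom Q X Y" "g \<in> Hom Q X Y" "f \<preceq> g" "g \<preceq> f"
  shows "f = g"
proof -
  interpret complete_lattice "hom_poset Q X Y" using assms hom_complete by blast
  show ?thesis using assms le_antisym[of f g] by (simp add: hom_poset_def)
qed

lemma leq_trans:
  assumes "X \<in> Ob Q" "Y \<in> Ob Q" "f \<in> Hom Q X Y" "g \<in> Hom Q X Y" "h \<in> Hom Q X Y"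
    and "f \<preceq> g" "g \<preceq> h"
  shows "f \<preceq> h"
proof -
  interpret complete_lattice "hom_poset Q X Y" using assms hom_complete by blast
  show ?thesis using assms le_trans[of f g h] by (simp add: hom_poset_def)
qed

lemma Join_in:
  assumes "X \<in> Ob Q" "Y \<in> Ob Q" "F \<subseteq> Hom Q X Y"
  shows "Join Q X Y F \<in> Hom Q X Y"
proof -
  interpret complete_lattice "hom_poset Q X Y" using assms hom_complete by blast
  show ?thesis using assms sup_closed[of F] by (simp add: hom_poset_def Join_def)
qed

lemma Join_upper:
  assumes "X \<in> Ob Q" "Y \<in> Ob Q" "F \<subseteq> Hom Q X Y" "f \<in> F"
  shows "f \<preceq> Join Q X Y F"
proof -
  interpret complete_lattice "hom_poset Q X Y" using assms hom_complete by blast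
  show ?thesis using assms sup_upper[of F f] by (simp add: hom_poset_def Join_def)
qed

lemma Join_least:
  assumes "X \<in> Ob Q" "Y \<in> Ob Q" "F \<subseteq> Hom Q X Y" "h \<in> Hom Q X Y" "\<And>f. f \<in> F \<Longrightarrow> f \<preceq> h"
  shows "Join Q X Y F \<preceq> h"
proof -
  interpret complete_lattice "hom_poset Q X Y" using assms hom_complete by blast
  show ?thesis using assms sup_least[of F h] by (simp add: hom_poset_def Join_def)
qed

lemma Join_le_iff:
  assumes "X \<in> Ob Q" "Y \<in> Ob Q" "F \<subseteq> Hom Q X Y" "h \<in> Hom Q X Y"
  shows "Join Q X Y F \<preceq> h \<longleftrightarrow> (\<forall>f \<in> F. f \<preceq> h)"
  using assms Join_least[OF assms(1-4)] Join_upper[OF assms(1-3)] Join_in[OF assms(1-3)]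
  by (meson leq_trans subsetD)

lemma arrow_eqI:
  assumes "X \<in> Ob Q" "Y \<in> Ob Q" "f \<in> Hom Q X Y" "g \<in> Hom Q X Y"
    and "\<And>k. k \<in> Hom Q X Y \<Longrightarrow> k \<preceq> f \<longleftrightarrow> k \<preceq> g"
  shows "f = g"
  using assms leq_refl leq_antisym by metis

text \<open>
  Monotonicity of composition is preservation of the binary joins
  \<open>f' = \<Squnion>{f, f'}\<close> of comparable arrows.
\<close>

lemma Join_pair:
  assumes "X \<in> Ob Q" "Y \<in> Ob Q" "f \<in> Hom Q X Y" "f' \<in> Hom Q X Y" "f \<preceq> f'"
  shows "Join Q X Y {f, f'} = f'"
  using assms
  by (intro leq_antisym[of X Y])
    (auto intro!: Join_in Join_least Join_upper leq_refl[of X Y])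

lemma cmp_mono_right:
  assumes "X \<in> Ob Q" "Y \<in> Ob Q" "Z \<in> Ob Q"
    and "f \<in> Hom Q X Y" "f' \<in> Hom Q X Y" "g \<in> Hom Q Y Z" "f \<preceq> f'"
  shows "g \<circ>\<circ> f \<preceq> g \<circ>\<circ> f'"
proof -
  have "g \<circ>\<circ> f' = Join Q X Z {g \<circ>\<circ> k | k. k \<in> {f, f'}}"
    using cmp_Join_right[of X Y Z "{f, f'}" g] Join_pair[of X Y f f'] assms by auto
  moreover have "g \<circ>\<circ> f \<preceq> Join Q X Z {g \<circ>\<circ> k | k. k \<in> {f, f'}}"
    using assms by (intro Join_upper) (auto intro: cmp_in[of X Y Z])
  ultimately show ?thesis by simp
qed

lemma cmp_mono_left:
  assumes "X \<in> Ob Q" "Y \<in> Ob Q" "Z \<in> Ob Q"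
    and "f \<in> Hom Q X Y" "g \<in> Hom Q Y Z" "g' \<in> Hom Q Y Z" "g \<preceq> g'"
  shows "g \<circ>\<circ> f \<preceq> g' \<circ>\<circ> f"
proof -
  have "g' \<circ>\<circ> f = Join Q X Z {k \<circ>\<circ> f | k. k \<in> {g, g'}}"
    using cmp_Join_left[of X Y Z f "{g, g'}"] Join_pair[of Y Z g g'] assms by auto
  moreover have "g \<circ>\<circ> f \<preceq> Join Q X Z {k \<circ>\<circ> f | k. k \<in> {g, g'}}"
    using assms by (intro Join_upper) (auto intro: cmp_in[of X Y Z])
  ultimately show ?thesis by simp
qed

text \<open>
  The join of all solutions \<open>k\<close> of the inequalities \<open>k \<circ>\<circ> f i \<preceq> h i\<close> is again a solution, because
  composition with \<open>f i\<close> preserves joins. It is the meet of the implications \<open>h i \<swarrow> f i\<close>.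
\<close>

lemma le_Join_left_implication_iff:
  assumes "Y \<in> Ob Q" "Z \<in> Ob Q" "\<And>i. i \<in> I \<Longrightarrow> t i \<in> Ob Q"
    and "\<And>i. i \<in> I \<Longrightarrow> f i \<in> Hom Q (t i) Y" "\<And>i. i \<in> I \<Longrightarrow> h i \<in> Hom Q (t i) Z"
    and g: "g \<in> Hom Q Y Z"
  shows "g \<preceq> Join Q Y Z {k \<in> Hom Q Y Z. \<forall>i \<in> I. k \<circ>\<circ> f i \<preceq> h i} \<longleftrightarrow> (\<forall>i \<in> I. g \<circ>\<circ> f i \<preceq> h i)"
    (is "_ \<preceq> ?J \<longleftrightarrow> _")
proof
  have J: "?J \<in> Hom Q Y Z" using assms by (intro Join_in) auto
  assume le: "g \<preceq> ?J"
  show "\<forall>i \<in> I. g \<circ>\<circ> f i \<preceq> h i"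
  proof
    fix i assume i: "i \<in> I"
    have "g \<circ>\<circ> f i \<preceq> ?J \<circ>\<circ> f i" using assms i J le by (intro cmp_mono_left[of "t i" Y Z]) auto
    moreover have "?J \<circ>\<circ> f i \<preceq> h i"
    proof -
      have "?J \<circ>\<circ> f i = Join Q (t i) Z {k \<circ>\<circ> f i | k. k \<in> {k \<in> Hom Q Y Z. \<forall>i \<in> I. k \<circ>\<circ> f i \<preceq> h i}}"
        using assms i by (intro cmp_Join_left[of "t i" Y Z]) auto
      also have "\<dots> \<preceq> h i" using assms i by (intro Join_least) (auto intro: cmp_in[of "t i" Y Z])
      finally show ?thesis .
    qed
    ultimately show "g \<circ>\<circ> f i \<preceq> h i"
      using assms i J
      by (intro leq_trans[of "t i" Z "g \<circ>\<circ> f i" "?J \<circ>\<circ> f i" "h i"]) (auto intro: cmp_in[of "t i" Y Z])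
  qed
next
  assume "\<forall>i \<in> I. g \<circ>\<circ> f i \<preceq> h i"
  then show "g \<preceq> ?J" using assms by (intro Join_upper) auto
qed

lemma le_Join_right_implication_iff:
  assumes "X \<in> Ob Q" "Y \<in> Ob Q" "\<And>i. i \<in> I \<Longrightarrow> t i \<in> Ob Q"
    and "\<And>i. i \<in> I \<Longrightarrow> g i \<in> Hom Q Y (t i)" "\<And>i. i \<in> I \<Longrightarrow> h i \<in> Hom Q X (t i)"
    and f: "f \<in> Hom Q X Y"
  shows "f \<preceq> Join Q X Y {k \<in> Hom Q X Y. \<forall>i \<in> I. g i \<circ>\<circ> k \<preceq> h i} \<longleftrightarrow> (\<forall>i \<in> I. g i \<circ>\<circ> f \<preceq> h i)"
    (is "_ \<preceq> ?J \<longleftrightarrow> _")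
proof
  have J: "?J \<in> Hom Q X Y" using assms by (intro Join_in) auto
  assume le: "f \<preceq> ?J"
  show "\<forall>i \<in> I. g i \<circ>\<circ> f \<preceq> h i"
  proof
    fix i assume i: "i \<in> I"
    have "g i \<circ>\<circ> f \<preceq> g i \<circ>\<circ> ?J" using assms i J le by (intro cmp_mono_right[of X Y "t i"]) auto
    moreover have "g i \<circ>\<circ> ?J \<preceq> h i"
    proof -
      have "g i \<circ>\<circ> ?J = Join Q X (t i) {g i \<circ>\<circ> k | k. k \<in> {k \<in> Hom Q X Y. \<forall>i \<in> I. g i \<circ>\<circ> k \<preceq> h i}}"
        using assms i by (intro cmp_Join_right[of X Y "t i"]) auto
      also have "\<dots> \<preceq> h i" using assms i by (intro Join_least) (auto intro: cmp_in[of X Y "t i"])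
      finally show ?thesis .
    qed
    ultimately show "g i \<circ>\<circ> f \<preceq> h i"
      using assms i J
      by (intro leq_trans[of X "t i" "g i \<circ>\<circ> f" "g i \<circ>\<circ> ?J" "h i"]) (auto intro: cmp_in[of X Y "t i"])
  qed
next
  assume "\<forall>i \<in> I. g i \<circ>\<circ> f \<preceq> h i"
  then show "f \<preceq> ?J" using assms by (intro Join_upper) auto
qed

end

section \<open>Distributors and their implications\<close>

lemma qcategory_tp: "\<lbrakk>qcategory Q A; x \<in> Obj A\<rbrakk> \<Longrightarrow> tp A x \<in> Ob Q"
  and qcategory_hm:
    "\<lbrakk>qcategory Q A; x \<in> Obj A; y \<in> Obj A\<rbrakk> \<Longrightarrow> hm A x y \<in> Hom Q (tp A x) (tp A y)"
  and qcategory_refl: "\<lbrakk>qcategory Q A; x \<in> Obj A\<rbrakk> \<Longrightarrow> ident Q (tp A x) \<preceq>\<^bsub>Q\<^esub> hm A x x"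
  and qcategory_trans:
    "\<lbrakk>qcategory Q A; x \<in> Obj A; y \<in> Obj A; z \<in> Obj A\<rbrakk>
      \<Longrightarrow> hm A y z \<circ>\<circ>\<^bsub>Q\<^esub> hm A x y \<preceq>\<^bsub>Q\<^esub> hm A x z"
  by (auto simp: qcategory_def)

lemma Obj_subcat [simp]: "Obj (subcat A S) = S"
  and tp_subcat [simp]: "tp (subcat A S) = tp A"
  and hm_subcat [simp]: "hm (subcat A S) = hm A"
  by (auto simp: subcat_def)

lemma Obj_star [simp]: "Obj (star Q X) = {()}"
  and tp_star [simp]: "tp (star Q X) x = X"
  and hm_star [simp]: "hm (star Q X) x y = ident Q X"
  by (auto simp: star_def)

lemma qcategory_subcat: "\<lbrakk>qcategory Q A; S \<subseteq> Obj A\<rbrakk> \<Longrightarrow> qcategory Q (subcat A S)"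
  unfolding qcategory_def by (simp add: subset_iff)

lemma distributor_in:
  "\<lbrakk>distributor Q A B \<phi>; x \<in> Obj A; y \<in> Obj B\<rbrakk> \<Longrightarrow> \<phi> (x, y) \<in> Hom Q (tp A x) (tp B y)"
  by (auto simp: distributor_def)

lemma distributor_ext: "distributor Q A B \<phi> \<Longrightarrow> \<phi> \<in> extensional (Obj A \<times> Obj B)"
  by (simp add: distributor_def)

lemma distributor_restrict:
  "\<lbrakk>distributor Q A B \<phi>; S \<subseteq> Obj A; T \<subseteq> Obj B\<rbrakk>
    \<Longrightarrow> distributor Q (subcat A S) (subcat B T) (dist_restrict \<phi> S T)"
  unfolding distributor_def dist_restrict_def by (auto simp: subset_iff)

context quantaloid
begin

lemma qcategory_star: "X \<in> Ob Q \<Longrightarrow> qcategory Q (star Q X)"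
  using ident_in[of X] ident_left[of X X] leq_refl[of X X "ident Q X"] by (auto simp: qcategory_def)

lemma distributor_act_left:
  assumes "qcategory Q A" "qcategory Q B" "distributor Q A B \<phi>"
    and x: "x \<in> Obj A" and y: "y \<in> Obj B" "y' \<in> Obj B"
  shows "hm B y y' \<circ>\<circ> \<phi> (x, y) \<preceq> \<phi> (x, y')"
proof -
  note tps = qcategory_tp[OF assms(1) x] qcategory_tp[OF assms(2) y(1)] qcategory_tp[OF assms(2) y(2)]
  have in_hom: "\<phi> (x, y) \<in> Hom Q (tp A x) (tp B y)" "\<phi> (x, y') \<in> Hom Q (tp A x) (tp B y')"
    using distributor_in[OF assms(3) x] y by auto
  have a: "hm A x x \<in> Hom Q (tp A x) (tp A x)" using qcategory_hm[OF assms(1) x x] .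
  let ?u = "hm B y y' \<circ>\<circ> \<phi> (x, y)"
  have u: "?u \<in> Hom Q (tp A x) (tp B y')"
    using cmp_in[OF tps in_hom(1)] qcategory_hm[OF assms(2) y] by simp
  have "?u \<circ>\<circ> ident Q (tp A x) \<preceq> ?u \<circ>\<circ> hm A x x"
    using cmp_mono_right[OF tps(1,1,3) ident_in[OF tps(1)] a u] qcategory_refl[OF assms(1) x] by simp
  then have "?u \<preceq> ?u \<circ>\<circ> hm A x x"
    using ident_right[OF tps(1,3) u] by simp
  moreover have "?u \<circ>\<circ> hm A x x \<preceq> \<phi> (x, y')"
    using assms by (simp add: distributor_def)
  ultimately show ?thesis
    using leq_trans[OF tps(1,3) u cmp_in[OF tps(1,1,3) a u] in_hom(2)] by simp
qed

lemma distributor_act_right: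
  assumes "qcategory Q A" "qcategory Q B" "distributor Q A B \<phi>"
    and x: "x \<in> Obj A" "x' \<in> Obj A" and y: "y \<in> Obj B"
  shows "\<phi> (x, y) \<circ>\<circ> hm A x' x \<preceq> \<phi> (x', y)"
proof -
  note tps = qcategory_tp[OF assms(1) x(2)] qcategory_tp[OF assms(1) x(1)] qcategory_tp[OF assms(2) y]
  have in_hom: "\<phi> (x, y) \<in> Hom Q (tp A x) (tp B y)" "\<phi> (x', y) \<in> Hom Q (tp A x') (tp B y)"
    using distributor_in[OF assms(3)] x y by auto
  have b: "hm B y y \<in> Hom Q (tp B y) (tp B y)" using qcategory_hm[OF assms(2) y y] .
  have a: "hm A x' x \<in> Hom Q (tp A x') (tp A x)" using qcategory_hm[OF assms(1) x(2,1)] .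
  let ?u = "hm B y y \<circ>\<circ> \<phi> (x, y)"
  have u: "?u \<in> Hom Q (tp A x) (tp B y)"
    using cmp_in[OF tps(2,3,3) in_hom(1) b] .
  have "ident Q (tp B y) \<circ>\<circ> \<phi> (x, y) \<preceq> ?u"
    using cmp_mono_left[OF tps(2,3,3) in_hom(1) ident_in[OF tps(3)] b] qcategory_refl[OF assms(2) y]
    by simp
  then have "\<phi> (x, y) \<preceq> ?u"
    using ident_left[OF tps(2,3) in_hom(1)] by simp
  then have "\<phi> (x, y) \<circ>\<circ> hm A x' x \<preceq> ?u \<circ>\<circ> hm A x' x"
    using cmp_mono_left[OF tps a in_hom(1) u] by simp
  moreover have "?u \<circ>\<circ> hm A x' x \<preceq> \<phi> (x', y)"
    using assms by (simp add: distributor_def)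
  ultimately show ?thesis
    using leq_trans[OF tps(1,3) cmp_in[OF tps a in_hom(1)] cmp_in[OF tps a u] in_hom(2)] by simp
qed

lemma distributorI:
  assumes "qcategory Q A" "qcategory Q B" "\<phi> \<in> extensional (Obj A \<times> Obj B)"
    and arrow: "\<And>x y. \<lbrakk>x \<in> Obj A; y \<in> Obj B\<rbrakk> \<Longrightarrow> \<phi> (x, y) \<in> Hom Q (tp A x) (tp B y)"
    and left: "\<And>x y y'. \<lbrakk>x \<in> Obj A; y \<in> Obj B; y' \<in> Obj B\<rbrakk> \<Longrightarrow> hm B y y' \<circ>\<circ> \<phi> (x, y) \<preceq> \<phi> (x, y')"
    and right: "\<And>x x' y. \<lbrakk>x \<in> Obj A; x' \<in> Obj A; y \<in> Obj B\<rbrakk> \<Longrightarrow> \<phi> (x, y) \<circ>\<circ> hm A x' x \<preceq> \<phi> (x', y)"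
  shows "distributor Q A B \<phi>"
  unfolding distributor_def
proof (intro conjI ballI)
  fix x x' y y' assume x: "x \<in> Obj A" "x' \<in> Obj A" and y: "y \<in> Obj B" "y' \<in> Obj B"
  note tpA = qcategory_tp[OF assms(1) x(2)] qcategory_tp[OF assms(1) x(1)]
    and tpB = qcategory_tp[OF assms(2) y(1)] qcategory_tp[OF assms(2) y(2)]
  have a: "hm A x' x \<in> Hom Q (tp A x') (tp A x)" using qcategory_hm[OF assms(1) x(2,1)] .
  let ?u = "hm B y y' \<circ>\<circ> \<phi> (x, y)"
  have u: "?u \<in> Hom Q (tp A x) (tp B y')"
    using cmp_in[OF tpA(2) tpB arrow[OF x(1) y(1)] qcategory_hm[OF assms(2) y]] .
  have "?u \<circ>\<circ> hm A x' x \<preceq> \<phi> (x, y') \<circ>\<circ> hm A x' x"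
    using cmp_mono_left[OF tpA tpB(2) a u arrow[OF x(1) y(2)] left[OF x(1) y]] .
  then show "?u \<circ>\<circ> hm A x' x \<preceq> \<phi> (x', y')"
    using leq_trans[OF tpA(1) tpB(2) cmp_in[OF tpA tpB(2) a u]
        cmp_in[OF tpA tpB(2) a arrow[OF x(1) y(2)]] arrow[OF x(2) y(2)]] right[OF x y(2)] by simp
qed (use assms(3) arrow in auto)

lemma dist_le_antisym:
  assumes "qcategory Q A" "qcategory Q B" "distributor Q A B \<phi>" "distributor Q A B \<psi>"
    and "dist_le Q A B \<phi> \<psi>" "dist_le Q A B \<psi> \<phi>"
  shows "\<phi> = \<psi>"
proof (rule extensionalityI[OF distributor_ext[OF assms(3)] distributor_ext[OF assms(4)]])
  fix p assume "p \<in> Obj A \<times> Obj B"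
  then obtain x y where p: "p = (x, y)" "x \<in> Obj A" "y \<in> Obj B" by auto
  show "\<phi> p = \<psi> p"
    unfolding p(1)
    using leq_antisym[OF qcategory_tp[OF assms(1) p(2)] qcategory_tp[OF assms(2) p(3)]
        distributor_in[OF assms(3) p(2,3)] distributor_in[OF assms(4) p(2,3)]]
      assms(5,6) p(2,3)
    by (simp add: dist_le_def)
qed

lemma dist_le_refl:
  assumes "qcategory Q A" "qcategory Q B" "distributor Q A B \<phi>"
  shows "dist_le Q A B \<phi> \<phi>"
  unfolding dist_le_def
  using leq_refl[OF qcategory_tp[OF assms(1)] qcategory_tp[OF assms(2)] distributor_in[OF assms(3)]]
  by blast

lemma dist_comp_summand_in:
  assumes "qcategory Q A" "qcategory Q B" "qcategory Q C"
    and "distributor Q A B \<phi>" "distributor Q B C \<psi>" "x \<in> Obj A" "z \<in> Obj C"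
  shows "{\<psi> (y, z) \<circ>\<circ> \<phi> (x, y) | y. y \<in> Obj B} \<subseteq> Hom Q (tp A x) (tp C z)"
  using cmp_in[OF qcategory_tp[OF assms(1)] qcategory_tp[OF assms(2)] qcategory_tp[OF assms(3)]
      distributor_in[OF assms(4)] distributor_in[OF assms(5)]] assms(6,7)
  by blast

lemma dist_comp_in:
  assumes "qcategory Q A" "qcategory Q B" "qcategory Q C"
    and "distributor Q A B \<phi>" "distributor Q B C \<psi>" "x \<in> Obj A" "z \<in> Obj C"
  shows "dist_comp Q A B C \<psi> \<phi> (x, z) \<in> Hom Q (tp A x) (tp C z)"
  using Join_in[OF qcategory_tp[OF assms(1,6)] qcategory_tp[OF assms(3,7)]
      dist_comp_summand_in[OF assms]] assms(6,7)
  by (simp add: dist_comp_def)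

lemma dist_comp_le_iff:
  assumes "qcategory Q A" "qcategory Q B" "qcategory Q C"
    and "distributor Q A B \<phi>" "distributor Q B C \<psi>" "x \<in> Obj A" "z \<in> Obj C"
    and "h \<in> Hom Q (tp A x) (tp C z)"
  shows "dist_comp Q A B C \<psi> \<phi> (x, z) \<preceq> h \<longleftrightarrow> (\<forall>y \<in> Obj B. \<psi> (y, z) \<circ>\<circ> \<phi> (x, y) \<preceq> h)"
proof -
  have "dist_comp Q A B C \<psi> \<phi> (x, z) =
      Join Q (tp A x) (tp C z) {\<psi> (y, z) \<circ>\<circ> \<phi> (x, y) | y. y \<in> Obj B}"
    using assms(6,7) by (simp add: dist_comp_def)
  then show ?thesis
    using Join_le_iff[OF qcategory_tp[OF assms(1,6)] qcategory_tp[OF assms(3,7)]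
        dist_comp_summand_in[OF assms(1-7)] assms(8)] by auto
qed


lemma dist_comp_distributor:
  assumes A: "qcategory Q A" and B: "qcategory Q B" and C: "qcategory Q C"
    and \<phi>: "distributor Q A B \<phi>" and \<psi>: "distributor Q B C \<psi>"
  shows "distributor Q A C (dist_comp Q A B C \<psi> \<phi>)" (is "distributor _ _ _ ?c")
proof (rule distributorI[OF A C])
  show "?c \<in> extensional (Obj A \<times> Obj C)" by (simp add: dist_comp_def)
  show "?c (x, z) \<in> Hom Q (tp A x) (tp C z)" if "x \<in> Obj A" "z \<in> Obj C" for x z
    using dist_comp_in[OF assms that] .
next
  fix x z z' assume x: "x \<in> Obj A" and z: "z \<in> Obj C" "z' \<in> Obj C"
  note tx = qcategory_tp[OF A x] and tz = qcategory_tp[OF C z(1)] qcategory_tp[OF C z(2)]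
  have c: "hm C z z' \<in> Hom Q (tp C z) (tp C z')" using qcategory_hm[OF C z] .
  have c_out: "?c (x, z') \<in> Hom Q (tp A x) (tp C z')" using dist_comp_in[OF assms x z(2)] .
  let ?F = "{\<psi> (y, z) \<circ>\<circ> \<phi> (x, y) | y. y \<in> Obj B}"
  have F: "?F \<subseteq> Hom Q (tp A x) (tp C z)" by (rule dist_comp_summand_in[OF assms x z(1)])
  have "hm C z z' \<circ>\<circ> ?c (x, z) = Join Q (tp A x) (tp C z') {hm C z z' \<circ>\<circ> f | f. f \<in> ?F}"
    using cmp_Join_right[OF tx tz F c] x z by (simp add: dist_comp_def)
  also have "\<dots> \<preceq> ?c (x, z')"
  proof (rule Join_least[OF tx tz(2) _ c_out])
    show "{hm C z z' \<circ>\<circ> f | f. f \<in> ?F} \<subseteq> Hom Q (tp A x) (tp C z')"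
      using cmp_in[OF tx tz _ c] F by blast
    fix h assume "h \<in> {hm C z z' \<circ>\<circ> f | f. f \<in> ?F}"
    then obtain y where y: "y \<in> Obj B" and h: "h = hm C z z' \<circ>\<circ> (\<psi> (y, z) \<circ>\<circ> \<phi> (x, y))" by auto
    note ty = qcategory_tp[OF B y]
    have f: "\<phi> (x, y) \<in> Hom Q (tp A x) (tp B y)" using distributor_in[OF \<phi> x y] .
    have g: "\<psi> (y, z) \<in> Hom Q (tp B y) (tp C z)" "\<psi> (y, z') \<in> Hom Q (tp B y) (tp C z')"
      using distributor_in[OF \<psi> y] z by auto
    have "h = (hm C z z' \<circ>\<circ> \<psi> (y, z)) \<circ>\<circ> \<phi> (x, y)"
      unfolding h using cmp_assoc[OF tx ty tz f g(1) c] .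
    also have "\<dots> \<preceq> \<psi> (y, z') \<circ>\<circ> \<phi> (x, y)"
      using cmp_mono_left[OF tx ty tz(2) f cmp_in[OF ty tz g(1) c] g(2)]
        distributor_act_left[OF B C \<psi> y z] .
    finally have 1: "h \<preceq> \<psi> (y, z') \<circ>\<circ> \<phi> (x, y)" .
    have 2: "\<psi> (y, z') \<circ>\<circ> \<phi> (x, y) \<preceq> ?c (x, z')"
      using dist_comp_le_iff[OF assms x z(2) c_out] leq_refl[OF tx tz(2) c_out] y by blast
    have "h \<in> Hom Q (tp A x) (tp C z')"
      unfolding h using cmp_in[OF tx tz cmp_in[OF tx ty tz(1) f g(1)] c] .
    then show "h \<preceq> ?c (x, z')"
      using leq_trans[OF tx tz(2) _ cmp_in[OF tx ty tz(2) f g(2)] c_out 1 2] by blast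
  qed
  finally show "hm C z z' \<circ>\<circ> ?c (x, z) \<preceq> ?c (x, z')" .
next
  fix x x' z assume x: "x \<in> Obj A" "x' \<in> Obj A" and z: "z \<in> Obj C"
  note tx = qcategory_tp[OF A x(2)] qcategory_tp[OF A x(1)] and tz = qcategory_tp[OF C z]
  have a: "hm A x' x \<in> Hom Q (tp A x') (tp A x)" using qcategory_hm[OF A x(2,1)] .
  have c_out: "?c (x', z) \<in> Hom Q (tp A x') (tp C z)" using dist_comp_in[OF assms x(2) z] .
  let ?F = "{\<psi> (y, z) \<circ>\<circ> \<phi> (x, y) | y. y \<in> Obj B}"
  have F: "?F \<subseteq> Hom Q (tp A x) (tp C z)" by (rule dist_comp_summand_in[OF assms x(1) z])
  have "?c (x, z) \<circ>\<circ> hm A x' x = Join Q (tp A x') (tp C z) {f \<circ>\<circ> hm A x' x | f. f \<in> ?F}"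
    using cmp_Join_left[OF tx tz a F] x z by (simp add: dist_comp_def)
  also have "\<dots> \<preceq> ?c (x', z)"
  proof (rule Join_least[OF tx(1) tz _ c_out])
    show "{f \<circ>\<circ> hm A x' x | f. f \<in> ?F} \<subseteq> Hom Q (tp A x') (tp C z)"
      using cmp_in[OF tx tz a] F by blast
    fix h assume "h \<in> {f \<circ>\<circ> hm A x' x | f. f \<in> ?F}"
    then obtain y where y: "y \<in> Obj B" and h: "h = (\<psi> (y, z) \<circ>\<circ> \<phi> (x, y)) \<circ>\<circ> hm A x' x" by auto
    note ty = qcategory_tp[OF B y]
    have f: "\<phi> (x, y) \<in> Hom Q (tp A x) (tp B y)" "\<phi> (x', y) \<in> Hom Q (tp A x') (tp B y)"
      using distributor_in[OF \<phi> _ y] x by auto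
    have g: "\<psi> (y, z) \<in> Hom Q (tp B y) (tp C z)" using distributor_in[OF \<psi> y z] .
    have "h = \<psi> (y, z) \<circ>\<circ> (\<phi> (x, y) \<circ>\<circ> hm A x' x)"
      unfolding h using cmp_assoc[OF tx ty tz a f(1) g] by simp
    also have "\<dots> \<preceq> \<psi> (y, z) \<circ>\<circ> \<phi> (x', y)"
      using cmp_mono_right[OF tx(1) ty tz cmp_in[OF tx ty a f(1)] f(2) g]
        distributor_act_right[OF A B \<phi> x y] .
    finally have 1: "h \<preceq> \<psi> (y, z) \<circ>\<circ> \<phi> (x', y)" .
    have 2: "\<psi> (y, z) \<circ>\<circ> \<phi> (x', y) \<preceq> ?c (x', z)"
      using dist_comp_le_iff[OF assms x(2) z c_out] leq_refl[OF tx(1) tz c_out] y by blast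
    have "h \<in> Hom Q (tp A x') (tp C z)"
      unfolding h using cmp_in[OF tx tz a cmp_in[OF tx(2) ty tz f(1) g]] .
    then show "h \<preceq> ?c (x', z)"
      using leq_trans[OF tx(1) tz _ cmp_in[OF tx(1) ty tz f(2) g] c_out 1 2] by blast
  qed
  finally show "?c (x, z) \<circ>\<circ> hm A x' x \<preceq> ?c (x', z)" .
qed

text \<open>
  The function \<open>k\<close> below, which assigns to \<open>(y, z)\<close> the meet of the arrows \<open>h (x, z) \<swarrow> f (x, y)\<close> over \<open>x\<close>, is a
  distributor with the universal property that defines the implication, so it is the implication.
\<close>

lemma dist_limp_pointwise:
  assumes A: "qcategory Q A" and B: "qcategory Q B" and C: "qcategory Q C"
    and f: "distributor Q A B f" and h: "distributor Q A C h"
  shows dist_limp_distributor: "distributor Q B C (dist_limp Q A B C h f)"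
    and le_dist_limp_iff: "\<And>y z g. \<lbrakk>y \<in> Obj B; z \<in> Obj C; g \<in> Hom Q (tp B y) (tp C z)\<rbrakk>
      \<Longrightarrow> g \<preceq> dist_limp Q A B C h f (y, z) \<longleftrightarrow> (\<forall>x \<in> Obj A. g \<circ>\<circ> f (x, y) \<preceq> h (x, z))"
proof -
  define k where "k = (\<lambda>(y, z) \<in> Obj B \<times> Obj C. Join Q (tp B y) (tp C z)
    {g \<in> Hom Q (tp B y) (tp C z). \<forall>x \<in> Obj A. g \<circ>\<circ> f (x, y) \<preceq> h (x, z)})"
  note tpA = qcategory_tp[OF A] and tpB = qcategory_tp[OF B] and tpC = qcategory_tp[OF C]
  note f_in = distributor_in[OF f] and h_in = distributor_in[OF h]
  have k_iff: "g \<preceq> k (y, z) \<longleftrightarrow> (\<forall>x \<in> Obj A. g \<circ>\<circ> f (x, y) \<preceq> h (x, z))"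
    if "y \<in> Obj B" "z \<in> Obj C" "g \<in> Hom Q (tp B y) (tp C z)" for y z g
    using le_Join_left_implication_iff[OF tpB[OF that(1)] tpC[OF that(2)] tpA f_in[OF _ that(1)]
        h_in[OF _ that(2)] that(3)] that by (simp add: k_def)
  have k_in: "k (y, z) \<in> Hom Q (tp B y) (tp C z)" if "y \<in> Obj B" "z \<in> Obj C" for y z
    using Join_in[OF tpB[OF that(1)] tpC[OF that(2)]] that by (simp add: k_def)
  have k_le: "k (y, z) \<circ>\<circ> f (x, y) \<preceq> h (x, z)"
    if "x \<in> Obj A" "y \<in> Obj B" "z \<in> Obj C" for x y z
    using k_iff[OF that(2,3) k_in[OF that(2,3)]] leq_refl[OF tpB[OF that(2)] tpC[OF that(3)] k_in[OF that(2,3)]]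
      that(1) by blast
  have dist_k: "distributor Q B C k"
  proof (rule distributorI[OF B C _ k_in])
    show "k \<in> extensional (Obj B \<times> Obj C)" by (simp add: k_def)
  next
    fix y z z' assume y: "y \<in> Obj B" and z: "z \<in> Obj C" "z' \<in> Obj C"
    note c = qcategory_hm[OF C z]
    have "hm C z z' \<circ>\<circ> k (y, z) \<circ>\<circ> f (x, y) \<preceq> h (x, z')" if x: "x \<in> Obj A" for x
    proof -
      note t = tpA[OF x] tpB[OF y] tpC[OF z(1)] tpC[OF z(2)]
      have kf: "k (y, z) \<circ>\<circ> f (x, y) \<in> Hom Q (tp A x) (tp C z)"
        using cmp_in[OF t(1-3) f_in[OF x y] k_in[OF y z(1)]] .
      have "hm C z z' \<circ>\<circ> (k (y, z) \<circ>\<circ> f (x, y)) \<preceq> hm C z z' \<circ>\<circ> h (x, z)"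
        using cmp_mono_right[OF t(1,3,4) kf h_in[OF x z(1)] c k_le[OF x y z(1)]] .
      then have "hm C z z' \<circ>\<circ> (k (y, z) \<circ>\<circ> f (x, y)) \<preceq> h (x, z')"
        using leq_trans[OF t(1,4) cmp_in[OF t(1,3,4) kf c] cmp_in[OF t(1,3,4) h_in[OF x z(1)] c]
            h_in[OF x z(2)]] distributor_act_left[OF A C h x z] by blast
      then show ?thesis using cmp_assoc[OF t f_in[OF x y] k_in[OF y z(1)] c] by simp
    qed
    then show "hm C z z' \<circ>\<circ> k (y, z) \<preceq> k (y, z')"
      using k_iff[OF y z(2) cmp_in[OF tpB[OF y] tpC[OF z(1)] tpC[OF z(2)] k_in[OF y z(1)] c]] by blast
  next
    fix y y' z assume y: "y \<in> Obj B" "y' \<in> Obj B" and z: "z \<in> Obj C"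
    note b = qcategory_hm[OF B y(2,1)]
    have "(k (y, z) \<circ>\<circ> hm B y' y) \<circ>\<circ> f (x, y') \<preceq> h (x, z)" if x: "x \<in> Obj A" for x
    proof -
      note t = tpA[OF x] tpB[OF y(2)] tpB[OF y(1)] tpC[OF z]
      have bf: "hm B y' y \<circ>\<circ> f (x, y') \<in> Hom Q (tp A x) (tp B y)"
        using cmp_in[OF t(1-3) f_in[OF x y(2)] b] .
      have "k (y, z) \<circ>\<circ> (hm B y' y \<circ>\<circ> f (x, y')) \<preceq> k (y, z) \<circ>\<circ> f (x, y)"
        using cmp_mono_right[OF t(1,3,4) bf f_in[OF x y(1)] k_in[OF y(1) z]]
          distributor_act_left[OF A B f x y(2,1)] by blast
      then have "k (y, z) \<circ>\<circ> (hm B y' y \<circ>\<circ> f (x, y')) \<preceq> h (x, z)"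
        using leq_trans[OF t(1,4) cmp_in[OF t(1,3,4) bf k_in[OF y(1) z]]
            cmp_in[OF t(1,3,4) f_in[OF x y(1)] k_in[OF y(1) z]] h_in[OF x z]] k_le[OF x y(1) z] by blast
      then show ?thesis using cmp_assoc[OF t f_in[OF x y(2)] b k_in[OF y(1) z]] by simp
    qed
    then show "k (y, z) \<circ>\<circ> hm B y' y \<preceq> k (y', z)"
      using k_iff[OF y(2) z cmp_in[OF tpB[OF y(2)] tpB[OF y(1)] tpC[OF z] b k_in[OF y(1) z]]] by blast
  qed
  have univ: "dist_le Q A C (dist_comp Q A B C g f) h \<longleftrightarrow> dist_le Q B C g k"
    if g: "distributor Q B C g" for g
    unfolding dist_le_def
    using dist_comp_le_iff[OF A B C f g _ _ h_in] k_iff[OF _ _ distributor_in[OF g]] by blast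
  have "dist_limp Q A B C h f = k"
    unfolding dist_limp_def
  proof (rule the_equality, intro conjI allI impI dist_k univ, assumption)
    fix k' assume k': "distributor Q B C k' \<and> (\<forall>g. distributor Q B C g \<longrightarrow>
      (dist_le Q A C (dist_comp Q A B C g f) h \<longleftrightarrow> dist_le Q B C g k'))"
    then have "dist_le Q B C k' k" "dist_le Q B C k k'"
      using univ dist_k dist_le_refl[OF B C] by blast+
    then show "k' = k" using dist_le_antisym[OF B C] k' dist_k by blast
  qed
  then show "distributor Q B C (dist_limp Q A B C h f)"
    and "\<And>y z g. \<lbrakk>y \<in> Obj B; z \<in> Obj C; g \<in> Hom Q (tp B y) (tp C z)\<rbrakk>
      \<Longrightarrow> g \<preceq> dist_limp Q A B C h f (y, z) \<longleftrightarrow> (\<forall>x \<in> Obj A. g \<circ>\<circ> f (x, y) \<preceq> h (x, z))"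
    using dist_k k_iff by simp_all
qed

lemma dist_rimp_pointwise:
  assumes A: "qcategory Q A" and B: "qcategory Q B" and C: "qcategory Q C"
    and g: "distributor Q B C g" and h: "distributor Q A C h"
  shows dist_rimp_distributor: "distributor Q A B (dist_rimp Q A B C g h)"
    and le_dist_rimp_iff: "\<And>x y f. \<lbrakk>x \<in> Obj A; y \<in> Obj B; f \<in> Hom Q (tp A x) (tp B y)\<rbrakk>
      \<Longrightarrow> f \<preceq> dist_rimp Q A B C g h (x, y) \<longleftrightarrow> (\<forall>z \<in> Obj C. g (y, z) \<circ>\<circ> f \<preceq> h (x, z))"
proof -
  define k where "k = (\<lambda>(x, y) \<in> Obj A \<times> Obj B. Join Q (tp A x) (tp B y)
    {f \<in> Hom Q (tp A x) (tp B y). \<forall>z \<in> Obj C. g (y, z) \<circ>\<circ> f \<preceq> h (x, z)})"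
  note tpA = qcategory_tp[OF A] and tpB = qcategory_tp[OF B] and tpC = qcategory_tp[OF C]
  note g_in = distributor_in[OF g] and h_in = distributor_in[OF h]
  have k_iff: "f \<preceq> k (x, y) \<longleftrightarrow> (\<forall>z \<in> Obj C. g (y, z) \<circ>\<circ> f \<preceq> h (x, z))"
    if "x \<in> Obj A" "y \<in> Obj B" "f \<in> Hom Q (tp A x) (tp B y)" for x y f
    using le_Join_right_implication_iff[OF tpA[OF that(1)] tpB[OF that(2)] tpC g_in[OF that(2)]
        h_in[OF that(1)] that(3)] that by (simp add: k_def)
  have k_in: "k (x, y) \<in> Hom Q (tp A x) (tp B y)" if "x \<in> Obj A" "y \<in> Obj B" for x y
    using Join_in[OF tpA[OF that(1)] tpB[OF that(2)]] that by (simp add: k_def)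
  have k_le: "g (y, z) \<circ>\<circ> k (x, y) \<preceq> h (x, z)"
    if "x \<in> Obj A" "y \<in> Obj B" "z \<in> Obj C" for x y z
    using k_iff[OF that(1,2) k_in[OF that(1,2)]] leq_refl[OF tpA[OF that(1)] tpB[OF that(2)] k_in[OF that(1,2)]]
      that(3) by blast
  have dist_k: "distributor Q A B k"
  proof (rule distributorI[OF A B _ k_in])
    show "k \<in> extensional (Obj A \<times> Obj B)" by (simp add: k_def)
  next
    fix x y y' assume x: "x \<in> Obj A" and y: "y \<in> Obj B" "y' \<in> Obj B"
    note b = qcategory_hm[OF B y]
    have "g (y', z) \<circ>\<circ> (hm B y y' \<circ>\<circ> k (x, y)) \<preceq> h (x, z)" if z: "z \<in> Obj C" for z
    proof -
      note t = tpA[OF x] tpB[OF y(1)] tpB[OF y(2)] tpC[OF z]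
      have gb: "g (y', z) \<circ>\<circ> hm B y y' \<in> Hom Q (tp B y) (tp C z)"
        using cmp_in[OF t(2-4) b g_in[OF y(2) z]] .
      have "(g (y', z) \<circ>\<circ> hm B y y') \<circ>\<circ> k (x, y) \<preceq> g (y, z) \<circ>\<circ> k (x, y)"
        using cmp_mono_left[OF t(1,2,4) k_in[OF x y(1)] gb g_in[OF y(1) z]]
          distributor_act_right[OF B C g y(2,1) z] by blast
      then have "(g (y', z) \<circ>\<circ> hm B y y') \<circ>\<circ> k (x, y) \<preceq> h (x, z)"
        using leq_trans[OF t(1,4) cmp_in[OF t(1,2,4) k_in[OF x y(1)] gb]
            cmp_in[OF t(1,2,4) k_in[OF x y(1)] g_in[OF y(1) z]] h_in[OF x z]] k_le[OF x y(1) z] by blast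
      then show ?thesis using cmp_assoc[OF t k_in[OF x y(1)] b g_in[OF y(2) z]] by simp
    qed
    then show "hm B y y' \<circ>\<circ> k (x, y) \<preceq> k (x, y')"
      using k_iff[OF x y(2) cmp_in[OF tpA[OF x] tpB[OF y(1)] tpB[OF y(2)] k_in[OF x y(1)] b]] by blast
  next
    fix x x' y assume x: "x \<in> Obj A" "x' \<in> Obj A" and y: "y \<in> Obj B"
    note a = qcategory_hm[OF A x(2,1)]
    have "g (y, z) \<circ>\<circ> (k (x, y) \<circ>\<circ> hm A x' x) \<preceq> h (x', z)" if z: "z \<in> Obj C" for z
    proof -
      note t = tpA[OF x(2)] tpA[OF x(1)] tpB[OF y] tpC[OF z]
      have gk: "g (y, z) \<circ>\<circ> k (x, y) \<in> Hom Q (tp A x) (tp C z)"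
        using cmp_in[OF t(2-4) k_in[OF x(1) y] g_in[OF y z]] .
      have "(g (y, z) \<circ>\<circ> k (x, y)) \<circ>\<circ> hm A x' x \<preceq> h (x, z) \<circ>\<circ> hm A x' x"
        using cmp_mono_left[OF t(1,2,4) a gk h_in[OF x(1) z] k_le[OF x(1) y z]] .
      then have "(g (y, z) \<circ>\<circ> k (x, y)) \<circ>\<circ> hm A x' x \<preceq> h (x', z)"
        using leq_trans[OF t(1,4) cmp_in[OF t(1,2,4) a gk] cmp_in[OF t(1,2,4) a h_in[OF x(1) z]]
            h_in[OF x(2) z]] distributor_act_right[OF A C h x z] by blast
      then show ?thesis using cmp_assoc[OF t a k_in[OF x(1) y] g_in[OF y z]] by simp
    qed
    then show "k (x, y) \<circ>\<circ> hm A x' x \<preceq> k (x', y)"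
      using k_iff[OF x(2) y cmp_in[OF tpA[OF x(2)] tpA[OF x(1)] tpB[OF y] a k_in[OF x(1) y]]] by blast
  qed
  have univ: "dist_le Q A C (dist_comp Q A B C g f) h \<longleftrightarrow> dist_le Q A B f k"
    if f: "distributor Q A B f" for f
    unfolding dist_le_def
    using dist_comp_le_iff[OF A B C f g _ _ h_in] k_iff[OF _ _ distributor_in[OF f]] by blast
  have "dist_rimp Q A B C g h = k"
    unfolding dist_rimp_def
  proof (rule the_equality, intro conjI allI impI dist_k univ, assumption)
    fix k' assume k': "distributor Q A B k' \<and> (\<forall>f. distributor Q A B f \<longrightarrow>
      (dist_le Q A C (dist_comp Q A B C g f) h \<longleftrightarrow> dist_le Q A B f k'))"
    then have "dist_le Q A B k' k" "dist_le Q A B k k'"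
      using univ dist_k dist_le_refl[OF A B] by blast+
    then show "k' = k" using dist_le_antisym[OF A B] k' dist_k by blast
  qed
  then show "distributor Q A B (dist_rimp Q A B C g h)"
    and "\<And>x y f. \<lbrakk>x \<in> Obj A; y \<in> Obj B; f \<in> Hom Q (tp A x) (tp B y)\<rbrakk>
      \<Longrightarrow> f \<preceq> dist_rimp Q A B C g h (x, y) \<longleftrightarrow> (\<forall>z \<in> Obj C. g (y, z) \<circ>\<circ> f \<preceq> h (x, z))"
    using dist_k k_iff by simp_all
qed

end

section \<open>Presheaves and the Isbell adjunction of a distributor\<close>

context quantaloid
begin

lemma tp_Psh [simp]: "tp (Psh Q A) = fst"
  by (simp add: Psh_def)

lemma Psh_iff: "p \<in> Obj (Psh Q A) \<longleftrightarrow> fst p \<in> Ob Q \<and> distributor Q A (star Q (fst p)) (snd p)"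
  by (cases p) (simp add: Psh_def)

lemma coPsh_iff: "k \<in> Obj (coPsh Q A) \<longleftrightarrow> fst k \<in> Ob Q \<and> distributor Q (star Q (fst k)) A (snd k)"
  by (cases k) (simp add: coPsh_def)

lemma Psh_Ob: "p \<in> Obj (Psh Q A) \<Longrightarrow> fst p \<in> Ob Q"
  and coPsh_Ob: "k \<in> Obj (coPsh Q A) \<Longrightarrow> fst k \<in> Ob Q"
  by (simp_all add: Psh_iff coPsh_iff)

lemma Psh_arrow: "\<lbrakk>p \<in> Obj (Psh Q A); x \<in> Obj A\<rbrakk> \<Longrightarrow> snd p (x, ()) \<in> Hom Q (tp A x) (fst p)"
  using distributor_in[of Q A "star Q (fst p)" "snd p" x "()"] by (simp add: Psh_iff)

lemma coPsh_arrow: "\<lbrakk>k \<in> Obj (coPsh Q A); x \<in> Obj A\<rbrakk> \<Longrightarrow> snd k ((), x) \<in> Hom Q (fst k) (tp A x)"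
  using distributor_in[of Q "star Q (fst k)" A "snd k" "()" x] by (simp add: coPsh_iff)

lemma Psh_eqI:
  assumes "p \<in> Obj (Psh Q A)" "p' \<in> Obj (Psh Q A)" "fst p = fst p'"
    and "\<And>x. x \<in> Obj A \<Longrightarrow> snd p (x, ()) = snd p' (x, ())"
  shows "p = p'"
proof (rule prod_eqI[OF assms(3)], rule extensionalityI)
  show "snd p \<in> extensional (Obj A \<times> {()})" "snd p' \<in> extensional (Obj A \<times> {()})"
    using assms(1,2) distributor_ext by (fastforce simp: Psh_iff)+
qed (use assms(4) in auto)

lemma coPsh_eqI:
  assumes "k \<in> Obj (coPsh Q A)" "k' \<in> Obj (coPsh Q A)" "fst k = fst k'"
    and "\<And>x. x \<in> Obj A \<Longrightarrow> snd k ((), x) = snd k' ((), x)"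
  shows "k = k'"
proof (rule prod_eqI[OF assms(3)], rule extensionalityI)
  show "snd k \<in> extensional ({()} \<times> Obj A)" "snd k' \<in> extensional ({()} \<times> Obj A)"
    using assms(1,2) distributor_ext by (fastforce simp: coPsh_iff)+
qed (use assms(4) in auto)

lemma
  assumes A: "qcategory Q A" and p: "p \<in> Obj (Psh Q A)" and p': "p' \<in> Obj (Psh Q A)"
  shows hm_Psh_in: "hm (Psh Q A) p p' \<in> Hom Q (fst p) (fst p')"
    and le_hm_Psh_iff: "g \<in> Hom Q (fst p) (fst p') \<Longrightarrow>
      g \<preceq> hm (Psh Q A) p p' \<longleftrightarrow> (\<forall>x \<in> Obj A. g \<circ>\<circ> snd p (x, ()) \<preceq> snd p' (x, ()))"
proof -
  have hm: "hm (Psh Q A) p p' =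
      dist_limp Q A (star Q (fst p)) (star Q (fst p')) (snd p') (snd p) ((), ())"
    by (simp add: Psh_def case_prod_unfold)
  note star = qcategory_star[OF Psh_Ob[OF p]] qcategory_star[OF Psh_Ob[OF p']]
  have dist: "distributor Q A (star Q (fst p)) (snd p)" "distributor Q A (star Q (fst p')) (snd p')"
    using p p' by (simp_all add: Psh_iff)
  show "hm (Psh Q A) p p' \<in> Hom Q (fst p) (fst p')"
    using distributor_in[OF dist_limp_distributor[OF A star dist], of "()" "()"] hm by simp
  show "g \<preceq> hm (Psh Q A) p p' \<longleftrightarrow> (\<forall>x \<in> Obj A. g \<circ>\<circ> snd p (x, ()) \<preceq> snd p' (x, ()))"
    if "g \<in> Hom Q (fst p) (fst p')"
    using le_dist_limp_iff[OF A star dist, of "()" "()" g] hm that by simp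
qed

lemma hm_Psh_eval:
  assumes "qcategory Q A" "p \<in> Obj (Psh Q A)" "p' \<in> Obj (Psh Q A)" "x \<in> Obj A"
  shows "hm (Psh Q A) p p' \<circ>\<circ> snd p (x, ()) \<preceq> snd p' (x, ())"
  using le_hm_Psh_iff[OF assms(1-3) hm_Psh_in[OF assms(1-3)]] assms(4)
    leq_refl[OF Psh_Ob[OF assms(2)] Psh_Ob[OF assms(3)] hm_Psh_in[OF assms(1-3)]] by blast

lemma underlying_le_Psh_iff:
  assumes "qcategory Q A" "p \<in> Obj (Psh Q A)" "p' \<in> Obj (Psh Q A)"
  shows "underlying_le Q (Psh Q A) p p' \<longleftrightarrow>
    fst p = fst p' \<and> (\<forall>x \<in> Obj A. snd p (x, ()) \<preceq> snd p' (x, ()))"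
proof (cases "fst p = fst p'")
  case True
  have "ident Q (fst p) \<preceq> hm (Psh Q A) p p' \<longleftrightarrow>
      (\<forall>x \<in> Obj A. ident Q (fst p) \<circ>\<circ> snd p (x, ()) \<preceq> snd p' (x, ()))"
    using le_hm_Psh_iff[OF assms] ident_in[OF Psh_Ob[OF assms(2)]] True by simp
  then show ?thesis
    using True ident_left[OF qcategory_tp[OF assms(1)] Psh_Ob[OF assms(2)] Psh_arrow[OF assms(2)]]
    by (simp add: underlying_le_def)
qed (simp add: underlying_le_def)

lemma qcategory_Psh:
  assumes A: "qcategory Q A"
  shows "qcategory Q (Psh Q A)"
  unfolding qcategory_def
proof (intro conjI ballI)
  fix p assume p: "p \<in> Obj (Psh Q A)"
  show "tp (Psh Q A) p \<in> Ob Q" using Psh_Ob[OF p] by simp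
  have "underlying_le Q (Psh Q A) p p"
    using underlying_le_Psh_iff[OF A p p]
      leq_refl[OF qcategory_tp[OF A] Psh_Ob[OF p] Psh_arrow[OF p]] by blast
  then show "ident Q (tp (Psh Q A) p) \<preceq> hm (Psh Q A) p p" by (simp add: underlying_le_def)
next
  fix p q assume "p \<in> Obj (Psh Q A)" "q \<in> Obj (Psh Q A)"
  then show "hm (Psh Q A) p q \<in> Hom Q (tp (Psh Q A) p) (tp (Psh Q A) q)"
    using hm_Psh_in[OF A] by simp
next
  fix p q r assume p: "p \<in> Obj (Psh Q A)" and q: "q \<in> Obj (Psh Q A)" and r: "r \<in> Obj (Psh Q A)"
  let ?h = "hm (Psh Q A)"
  note obs = Psh_Ob[OF p] Psh_Ob[OF q] Psh_Ob[OF r]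
  note f = hm_Psh_in[OF A p q] and g = hm_Psh_in[OF A q r]
  have "(?h q r \<circ>\<circ> ?h p q) \<circ>\<circ> snd p (x, ()) \<preceq> snd r (x, ())" if x: "x \<in> Obj A" for x
  proof -
    note tx = qcategory_tp[OF A x]
    note px = Psh_arrow[OF p x] and qx = Psh_arrow[OF q x] and rx = Psh_arrow[OF r x]
    have "?h q r \<circ>\<circ> (?h p q \<circ>\<circ> snd p (x, ())) \<preceq> ?h q r \<circ>\<circ> snd q (x, ())"
      using cmp_mono_right[OF tx obs(2,3) cmp_in[OF tx obs(1,2) px f] qx g hm_Psh_eval[OF A p q x]] .
    then show ?thesis
      using leq_trans[OF tx obs(3) cmp_in[OF tx obs(2,3) cmp_in[OF tx obs(1,2) px f] g]
          cmp_in[OF tx obs(2,3) qx g] rx _ hm_Psh_eval[OF A q r x]] cmp_assoc[OF tx obs px f g]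
      by simp
  qed
  then show "?h q r \<circ>\<circ> ?h p q \<preceq> ?h p r"
    using le_hm_Psh_iff[OF A p r cmp_in[OF obs f g]] by blast
qed

end

locale qdistributor = quantaloid Q for Q :: "('o, 'm) quantaloid" (structure) +
  fixes A :: "('a, 'o, 'm) qcat" and B :: "('b, 'o, 'm) qcat" and \<phi> :: "'a \<times> 'b \<Rightarrow> 'm"
  assumes A: "qcategory Q A" and B: "qcategory Q B" and \<phi>: "distributor Q A B \<phi>"
begin

abbreviation upper :: "('a, 'o, 'm) presheaf \<Rightarrow> ('b, 'o, 'm) copresheaf" where
  "upper \<equiv> up Q A B \<phi>"

abbreviation lower :: "('b, 'o, 'm) copresheaf \<Rightarrow> ('a, 'o, 'm) presheaf" where
  "lower \<equiv> down Q A B \<phi>"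

abbreviation closure :: "('a, 'o, 'm) presheaf \<Rightarrow> ('a, 'o, 'm) presheaf" where
  "closure p \<equiv> lower (upper p)"

abbreviation M :: "(('a, 'o, 'm) presheaf, 'o, 'm) qcat" where
  "M \<equiv> M_cat Q A B \<phi>"

lemmas tpA = qcategory_tp[OF A]
  and tpB = qcategory_tp[OF B]
  and \<phi>_in = distributor_in[OF \<phi>]

lemma up_eq: "p \<in> Obj (Psh Q A) \<Longrightarrow> upper p = (fst p, dist_limp Q A (star Q (fst p)) B \<phi> (snd p))"
  by (simp add: up_def case_prod_unfold)

lemma down_eq: "k \<in> Obj (coPsh Q B) \<Longrightarrow> lower k = (fst k, dist_rimp Q A (star Q (fst k)) B (snd k) \<phi>)"
  by (simp add: down_def case_prod_unfold)

lemma fst_up [simp]: "p \<in> Obj (Psh Q A) \<Longrightarrow> fst (upper p) = fst p"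
  by (simp add: up_eq)

lemma fst_down [simp]: "k \<in> Obj (coPsh Q B) \<Longrightarrow> fst (lower k) = fst k"
  by (simp add: down_eq)

lemma
  assumes p: "p \<in> Obj (Psh Q A)"
  shows up_in: "upper p \<in> Obj (coPsh Q B)"
    and le_up_iff: "\<And>y g. \<lbrakk>y \<in> Obj B; g \<in> Hom Q (fst p) (tp B y)\<rbrakk> \<Longrightarrow>
      g \<preceq> snd (upper p) ((), y) \<longleftrightarrow> (\<forall>x \<in> Obj A. g \<circ>\<circ> snd p (x, ()) \<preceq> \<phi> (x, y))"
proof -
  note X = Psh_Ob[OF p]
  have dist: "distributor Q A (star Q (fst p)) (snd p)" using p by (simp add: Psh_iff)
  show "upper p \<in> Obj (coPsh Q B)"
    using dist_limp_distributor[OF A qcategory_star[OF X] B dist \<phi>] X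
    by (simp add: up_eq[OF p] coPsh_iff)
  show "g \<preceq> snd (upper p) ((), y) \<longleftrightarrow> (\<forall>x \<in> Obj A. g \<circ>\<circ> snd p (x, ()) \<preceq> \<phi> (x, y))"
    if "y \<in> Obj B" "g \<in> Hom Q (fst p) (tp B y)" for y g
    using le_dist_limp_iff[OF A qcategory_star[OF X] B dist \<phi>, of "()" y g] that
    by (simp add: up_eq[OF p])
qed

lemma
  assumes k: "k \<in> Obj (coPsh Q B)"
  shows down_in: "lower k \<in> Obj (Psh Q A)"
    and le_down_iff: "\<And>x f. \<lbrakk>x \<in> Obj A; f \<in> Hom Q (tp A x) (fst k)\<rbrakk> \<Longrightarrow>
      f \<preceq> snd (lower k) (x, ()) \<longleftrightarrow> (\<forall>y \<in> Obj B. snd k ((), y) \<circ>\<circ> f \<preceq> \<phi> (x, y))"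
proof -
  note X = coPsh_Ob[OF k]
  have dist: "distributor Q (star Q (fst k)) B (snd k)" using k by (simp add: coPsh_iff)
  show "lower k \<in> Obj (Psh Q A)"
    using dist_rimp_distributor[OF A qcategory_star[OF X] B dist \<phi>] X
    by (simp add: down_eq[OF k] Psh_iff)
  show "f \<preceq> snd (lower k) (x, ()) \<longleftrightarrow> (\<forall>y \<in> Obj B. snd k ((), y) \<circ>\<circ> f \<preceq> \<phi> (x, y))"
    if "x \<in> Obj A" "f \<in> Hom Q (tp A x) (fst k)" for x f
    using le_dist_rimp_iff[OF A qcategory_star[OF X] B dist \<phi>, of x "()" f] that
    by (simp add: down_eq[OF k])
qed

lemma up_arrow:
  "\<lbrakk>p \<in> Obj (Psh Q A); y \<in> Obj B\<rbrakk> \<Longrightarrow> snd (upper p) ((), y) \<in> Hom Q (fst p) (tp B y)"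
  using coPsh_arrow[OF up_in, of p y] by simp

lemma down_arrow:
  "\<lbrakk>k \<in> Obj (coPsh Q B); x \<in> Obj A\<rbrakk> \<Longrightarrow> snd (lower k) (x, ()) \<in> Hom Q (tp A x) (fst k)"
  using Psh_arrow[OF down_in, of k x] by simp

lemma closure_in: "p \<in> Obj (Psh Q A) \<Longrightarrow> closure p \<in> Obj (Psh Q A)"
  by (simp add: down_in up_in)

lemma fst_closure [simp]: "p \<in> Obj (Psh Q A) \<Longrightarrow> fst (closure p) = fst p"
  by (simp add: up_in)

lemma up_eval:
  assumes "p \<in> Obj (Psh Q A)" "x \<in> Obj A" "y \<in> Obj B"
  shows "snd (upper p) ((), y) \<circ>\<circ> snd p (x, ()) \<preceq> \<phi> (x, y)"
  using le_up_iff[OF assms(1,3) up_arrow[OF assms(1,3)]] assms(2)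
    leq_refl[OF Psh_Ob[OF assms(1)] tpB[OF assms(3)] up_arrow[OF assms(1,3)]] by blast

lemma down_eval:
  assumes "k \<in> Obj (coPsh Q B)" "x \<in> Obj A" "y \<in> Obj B"
  shows "snd k ((), y) \<circ>\<circ> snd (lower k) (x, ()) \<preceq> \<phi> (x, y)"
  using le_down_iff[OF assms(1,2) down_arrow[OF assms(1,2)]] assms(3)
    leq_refl[OF tpA[OF assms(2)] coPsh_Ob[OF assms(1)] down_arrow[OF assms(1,2)]] by blast

text \<open>
  The statement with an arbitrary arrow \<open>g\<close> in place of an inequality \<open>p \<le> p'\<close> is what functoriality
  asks for: \<open>g\<close> ranges over the arrows below the hom-arrow from \<open>p\<close> to \<open>p'\<close>. The pointwise order is
  the case where \<open>g\<close> is an identity.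
\<close>

lemma up_antitone:
  assumes p: "p \<in> Obj (Psh Q A)" and p': "p' \<in> Obj (Psh Q A)" and g: "g \<in> Hom Q (fst p) (fst p')"
    and le: "\<And>x. x \<in> Obj A \<Longrightarrow> g \<circ>\<circ> snd p (x, ()) \<preceq> snd p' (x, ())"
    and y: "y \<in> Obj B"
  shows "snd (upper p') ((), y) \<circ>\<circ> g \<preceq> snd (upper p) ((), y)"
proof -
  note X = Psh_Ob[OF p] and X' = Psh_Ob[OF p'] and u' = up_arrow[OF p' y]
  have "(snd (upper p') ((), y) \<circ>\<circ> g) \<circ>\<circ> snd p (x, ()) \<preceq> \<phi> (x, y)" if x: "x \<in> Obj A" for x
  proof -
    note tx = tpA[OF x] and px = Psh_arrow[OF p x] and px' = Psh_arrow[OF p' x]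
    have gp: "g \<circ>\<circ> snd p (x, ()) \<in> Hom Q (tp A x) (fst p')" using cmp_in[OF tx X X' px g] .
    have "snd (upper p') ((), y) \<circ>\<circ> (g \<circ>\<circ> snd p (x, ())) \<preceq> \<phi> (x, y)"
      using leq_trans[OF tx tpB[OF y] cmp_in[OF tx X' tpB[OF y] gp u']
          cmp_in[OF tx X' tpB[OF y] px' u'] \<phi>_in[OF x y]
          cmp_mono_right[OF tx X' tpB[OF y] gp px' u' le[OF x]] up_eval[OF p' x y]] .
    then show ?thesis using cmp_assoc[OF tx X X' tpB[OF y] px g u'] by simp
  qed
  then show ?thesis using le_up_iff[OF p y cmp_in[OF X X' tpB[OF y] g u']] by blast
qed

lemma down_antitone:
  assumes k: "k \<in> Obj (coPsh Q B)" and k': "k' \<in> Obj (coPsh Q B)" and g: "g \<in> Hom Q (fst k) (fst k')"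
    and le: "\<And>y. y \<in> Obj B \<Longrightarrow> snd k' ((), y) \<circ>\<circ> g \<preceq> snd k ((), y)"
    and x: "x \<in> Obj A"
  shows "g \<circ>\<circ> snd (lower k) (x, ()) \<preceq> snd (lower k') (x, ())"
proof -
  note X = coPsh_Ob[OF k] and X' = coPsh_Ob[OF k'] and d = down_arrow[OF k x]
  have "snd k' ((), y) \<circ>\<circ> (g \<circ>\<circ> snd (lower k) (x, ())) \<preceq> \<phi> (x, y)" if y: "y \<in> Obj B" for y
  proof -
    note ty = tpB[OF y] and ky = coPsh_arrow[OF k y] and ky' = coPsh_arrow[OF k' y]
    have kg: "snd k' ((), y) \<circ>\<circ> g \<in> Hom Q (fst k) (tp B y)" using cmp_in[OF X X' ty g ky'] .
    have "(snd k' ((), y) \<circ>\<circ> g) \<circ>\<circ> snd (lower k) (x, ()) \<preceq> \<phi> (x, y)"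
      using leq_trans[OF tpA[OF x] ty cmp_in[OF tpA[OF x] X ty d kg] cmp_in[OF tpA[OF x] X ty d ky]
          \<phi>_in[OF x y] cmp_mono_left[OF tpA[OF x] X ty d kg ky le[OF y]] down_eval[OF k x y]] .
    then show ?thesis using cmp_assoc[OF tpA[OF x] X X' ty d g ky'] by simp
  qed
  then show ?thesis using le_down_iff[OF k' x cmp_in[OF tpA[OF x] X X' d g]] by blast
qed

lemma le_closure:
  assumes p: "p \<in> Obj (Psh Q A)" and x: "x \<in> Obj A"
  shows "snd p (x, ()) \<preceq> snd (closure p) (x, ())"
  using le_down_iff[OF up_in[OF p] x] Psh_arrow[OF p x] up_eval[OF p x] by (simp add: p)

lemma up_closure:
  assumes p: "p \<in> Obj (Psh Q A)"
  shows "upper (closure p) = upper p"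
proof (rule coPsh_eqI)
  note c = closure_in[OF p] and X = Psh_Ob[OF p]
  show "upper (closure p) \<in> Obj (coPsh Q B)" "upper p \<in> Obj (coPsh Q B)" using up_in p c by blast+
  show "fst (upper (closure p)) = fst (upper p)" using p c by simp
  fix y assume y: "y \<in> Obj B"
  have in_hom: "snd (upper (closure p)) ((), y) \<in> Hom Q (fst p) (tp B y)"
    using up_arrow[OF c y] p by simp
  have "ident Q (fst p) \<circ>\<circ> snd p (x, ()) \<preceq> snd (closure p) (x, ())" if "x \<in> Obj A" for x
    using ident_left[OF tpA[OF that] X Psh_arrow[OF p that]] le_closure[OF p that] by simp
  then have "snd (upper (closure p)) ((), y) \<circ>\<circ> ident Q (fst p) \<preceq> snd (upper p) ((), y)"
    using up_antitone[OF p c, of "ident Q (fst p)"] ident_in[OF X] y p by simp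
  then have "snd (upper (closure p)) ((), y) \<preceq> snd (upper p) ((), y)"
    using ident_right[OF X tpB[OF y] in_hom] by simp
  moreover have "snd (upper p) ((), y) \<preceq> snd (upper (closure p)) ((), y)"
    using le_up_iff[OF c y] up_arrow[OF p y] down_eval[OF up_in[OF p] _ y] p by simp
  ultimately show "snd (upper (closure p)) ((), y) = snd (upper p) ((), y)"
    using leq_antisym[OF X tpB[OF y] in_hom up_arrow[OF p y]] by blast
qed

lemma closure_down:
  assumes k: "k \<in> Obj (coPsh Q B)"
  shows "closure (lower k) = lower k"
proof (rule Psh_eqI)
  note d = down_in[OF k] and X = coPsh_Ob[OF k]
  show "closure (lower k) \<in> Obj (Psh Q A)" "lower k \<in> Obj (Psh Q A)" using closure_in d by blast+
  show "fst (closure (lower k)) = fst (lower k)" using d by simp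
  fix x assume x: "x \<in> Obj A"
  have in_hom: "snd (closure (lower k)) (x, ()) \<in> Hom Q (tp A x) (fst k)"
    using Psh_arrow[OF closure_in[OF d] x] d k by simp
  have "snd k ((), y) \<circ>\<circ> ident Q (fst k) \<preceq> snd (upper (lower k)) ((), y)" if "y \<in> Obj B" for y
    using ident_right[OF X tpB[OF that] coPsh_arrow[OF k that]]
      le_up_iff[OF d that] coPsh_arrow[OF k that] down_eval[OF k _ that] k by simp
  then have "ident Q (fst k) \<circ>\<circ> snd (closure (lower k)) (x, ()) \<preceq> snd (lower k) (x, ())"
    using down_antitone[OF up_in[OF d] k, of "ident Q (fst k)"] ident_in[OF X] x k d by simp
  then have "snd (closure (lower k)) (x, ()) \<preceq> snd (lower k) (x, ())"
    using ident_left[OF tpA[OF x] X in_hom] by simp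
  then show "snd (closure (lower k)) (x, ()) = snd (lower k) (x, ())"
    using leq_antisym[OF tpA[OF x] X in_hom down_arrow[OF k x]] le_closure[OF d x] by blast
qed

lemma Obj_M_iff: "p \<in> Obj M \<longleftrightarrow> p \<in> Obj (Psh Q A) \<and> closure p = p"
  by (simp add: M_cat_def)

lemma M_Psh: "p \<in> Obj M \<Longrightarrow> p \<in> Obj (Psh Q A)"
  and M_closure: "p \<in> Obj M \<Longrightarrow> closure p = p"
  by (simp_all add: Obj_M_iff)

lemma tp_M [simp]: "tp M = fst"
  and hm_M [simp]: "hm M = hm (Psh Q A)"
  by (simp_all add: M_cat_def)

lemma down_in_M: "k \<in> Obj (coPsh Q B) \<Longrightarrow> lower k \<in> Obj M"
  using closure_down down_in by (simp add: Obj_M_iff)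

lemma qcategory_M: "qcategory Q M"
  unfolding M_cat_def by (rule qcategory_subcat[OF qcategory_Psh[OF A]]) auto

lemma underlying_le_M_iff:
  assumes "p \<in> Obj M" "p' \<in> Obj M"
  shows "underlying_le Q M p p' \<longleftrightarrow>
    fst p = fst p' \<and> (\<forall>x \<in> Obj A. snd p (x, ()) \<preceq> snd p' (x, ()))"
  using underlying_le_Psh_iff[OF A M_Psh[OF assms(1)] M_Psh[OF assms(2)]]
  by (simp add: underlying_le_def)

lemma M_skeletal:
  assumes p: "p \<in> Obj M" and p': "p' \<in> Obj M"
    and "underlying_le Q M p p'" "underlying_le Q M p' p"
  shows "p = p'"
proof (rule Psh_eqI[OF M_Psh[OF p] M_Psh[OF p']])
  have le: "fst p = fst p'"
      "\<And>x. x \<in> Obj A \<Longrightarrow> snd p (x, ()) \<preceq> snd p' (x, ()) \<and> snd p' (x, ()) \<preceq> snd p (x, ())"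
    using assms underlying_le_M_iff by simp_all
  show "fst p = fst p'" using le by simp
  fix x assume x: "x \<in> Obj A"
  show "snd p (x, ()) = snd p' (x, ())"
    using leq_antisym[OF tpA[OF x] Psh_Ob[OF M_Psh[OF p]] Psh_arrow[OF M_Psh[OF p] x]]
      Psh_arrow[OF M_Psh[OF p'] x] le(2)[OF x] le(1) by simp
qed

end

section \<open>Adjunctions between skeletal categories\<close>

context quantaloid
begin

lemma underlying_le_trans:
  assumes C: "qcategory Q C" and x: "x \<in> Obj C" and y: "y \<in> Obj C" and z: "z \<in> Obj C"
    and xy: "underlying_le Q C x y" and yz: "underlying_le Q C y z"
  shows "underlying_le Q C x z"
proof -
  let ?X = "tp C x"
  have eq: "tp C y = ?X" "tp C z = ?X" and le: "ident Q ?X \<preceq> hm C x y" "ident Q ?X \<preceq> hm C y z"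
    using xy yz unfolding underlying_le_def by auto
  have X: "?X \<in> Ob Q" using qcategory_tp[OF C x] .
  have f: "hm C x y \<in> Hom Q ?X ?X" and g: "hm C y z \<in> Hom Q ?X ?X" and h: "hm C x z \<in> Hom Q ?X ?X"
    using qcategory_hm[OF C x y] qcategory_hm[OF C y z] qcategory_hm[OF C x z] eq by simp_all
  note i = ident_in[OF X]
  have "hm C y z \<circ>\<circ> ident Q ?X \<preceq> hm C y z \<circ>\<circ> hm C x y"
    using cmp_mono_right[OF X X X i f g le(1)] .
  then have "hm C y z \<preceq> hm C y z \<circ>\<circ> hm C x y" using ident_right[OF X X g] by simp
  then have "ident Q ?X \<preceq> hm C y z \<circ>\<circ> hm C x y"
    using leq_trans[OF X X i g cmp_in[OF X X X f g] le(2)] by blast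
  then have "ident Q ?X \<preceq> hm C x z"
    using leq_trans[OF X X i cmp_in[OF X X X f g] h] qcategory_trans[OF C x y z] by blast
  then show ?thesis using eq by (simp add: underlying_le_def)
qed

lemma qfunctor_underlying_le:
  assumes C: "qcategory Q C" and D: "qcategory Q D" and F: "qfunctor Q C D F"
    and x: "x \<in> Obj C" and y: "y \<in> Obj C" and le: "underlying_le Q C x y"
  shows "underlying_le Q D (F x) (F y)"
proof -
  have Fx: "F x \<in> Obj D" "F y \<in> Obj D" "tp D (F x) = tp C x" "tp D (F y) = tp C y"
    and hm: "hm C x y \<preceq> hm D (F x) (F y)"
    using F x y by (auto simp: qfunctor_def)
  have eq: "tp C y = tp C x" and i: "ident Q (tp C x) \<preceq> hm C x y"
    using le unfolding underlying_le_def by auto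
  note X = qcategory_tp[OF C x]
  have "hm C x y \<in> Hom Q (tp C x) (tp C x)" "hm D (F x) (F y) \<in> Hom Q (tp C x) (tp C x)"
    using qcategory_hm[OF C x y] qcategory_hm[OF D Fx(1,2)] Fx(3,4) eq by simp_all
  then have "ident Q (tp C x) \<preceq> hm D (F x) (F y)"
    using leq_trans[OF X X ident_in[OF X] _ _ i hm] by blast
  then show ?thesis using Fx(3,4) eq by (simp add: underlying_le_def)
qed

text \<open>
  \<open>G y \<le> G' (F (G y)) \<le> G' y\<close>, by the unit of the second adjunction and the counit of the first.
\<close>

lemma right_adjoints_le:
  assumes C: "qcategory Q C" and D: "qcategory Q D"
    and G: "adjunction Q C D F G" and G': "adjunction Q C D F G'" and y: "y \<in> Obj D"
  shows "underlying_le Q C (G y) (G' y)"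
proof -
  have fun_G': "qfunctor Q D C G'" using G' by (simp add: adjunction_def)
  have Gy: "G y \<in> Obj C" using G y by (auto simp: adjunction_def qfunctor_def)
  have FGy: "F (G y) \<in> Obj D" using G Gy by (auto simp: adjunction_def qfunctor_def)
  have in_C: "G' (F (G y)) \<in> Obj C" "G' y \<in> Obj C" using fun_G' FGy y by (auto simp: qfunctor_def)
  have "underlying_le Q C (G y) (G' (F (G y)))"
    using G' Gy by (auto simp: adjunction_def functor_le_def id_functor_def compose_def)
  moreover have "underlying_le Q D (F (G y)) y"
    using G y by (auto simp: adjunction_def functor_le_def id_functor_def compose_def)
  ultimately show ?thesis
    using underlying_le_trans[OF C Gy in_C] qfunctor_underlying_le[OF D C fun_G' FGy y] by blast
qed

lemma right_adjoint_eqI: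
  assumes C: "qcategory Q C" and D: "qcategory Q D"
    and skeletal: "\<And>x y. \<lbrakk>x \<in> Obj C; y \<in> Obj C; underlying_le Q C x y; underlying_le Q C y x\<rbrakk> \<Longrightarrow> x = y"
    and G: "adjunction Q C D F G"
  shows "right_adjoint Q C D F = G"
  unfolding right_adjoint_def
proof (rule the_equality, rule G)
  fix G' assume G': "adjunction Q C D F G'"
  have ext: "G \<in> Obj D \<rightarrow>\<^sub>E Obj C" "G' \<in> Obj D \<rightarrow>\<^sub>E Obj C"
    using G G' by (simp_all add: adjunction_def qfunctor_def)
  show "G' = G"
  proof (rule PiE_ext[OF ext(2,1)])
    fix y assume y: "y \<in> Obj D"
    show "G' y = G y"
      using skeletal[OF PiE_mem[OF ext(2) y] PiE_mem[OF ext(1) y]]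
        right_adjoints_le[OF C D G' G y] right_adjoints_le[OF C D G G' y] by blast
  qed
qed

text \<open>
  An arrow lies below a hom-arrow of presheaves iff its action on the first presheaf lies below the
  second. So functoriality is preservation of all inequalities \<open>g \<cdot> p \<le> p'\<close>, and no hom-arrow has to
  be computed.
\<close>

lemma M_functorI:
  assumes A: "qdistributor Q A B \<phi>" and A': "qdistributor Q A' B' \<phi>'"
    and F: "F \<in> Obj (M_cat Q A B \<phi>) \<rightarrow>\<^sub>E Obj (M_cat Q A' B' \<phi>')"
    and fst_F: "\<And>p. p \<in> Obj (M_cat Q A B \<phi>) \<Longrightarrow> fst (F p) = fst p"
    and le: "\<And>p p' g x. \<lbrakk>p \<in> Obj (M_cat Q A B \<phi>); p' \<in> Obj (M_cat Q A B \<phi>);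
        g \<in> Hom Q (fst p) (fst p'); \<And>x. x \<in> Obj A \<Longrightarrow> g \<circ>\<circ> snd p (x, ()) \<preceq> snd p' (x, ()); x \<in> Obj A'\<rbrakk>
      \<Longrightarrow> g \<circ>\<circ> snd (F p) (x, ()) \<preceq> snd (F p') (x, ())"
  shows "qfunctor Q (M_cat Q A B \<phi>) (M_cat Q A' B' \<phi>') F"
proof -
  interpret X: qdistributor Q A B \<phi> by fact
  interpret Y: qdistributor Q A' B' \<phi>' by fact
  have "hm (Psh Q A) p p' \<preceq> hm (Psh Q A') (F p) (F p')" if p: "p \<in> Obj X.M" "p' \<in> Obj X.M" for p p'
  proof -
    note psh = X.M_Psh[OF p(1)] X.M_Psh[OF p(2)]
    note hm = hm_Psh_in[OF X.A psh]
    have Fp: "F p \<in> Obj (Psh Q A')" "F p' \<in> Obj (Psh Q A')" using F p Y.M_Psh by blast+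
    have "hm (Psh Q A) p p' \<circ>\<circ> snd (F p) (x, ()) \<preceq> snd (F p') (x, ())" if "x \<in> Obj A'" for x
      using le[OF p hm _ that] hm_Psh_eval[OF X.A psh] by blast
    then show ?thesis using le_hm_Psh_iff[OF Y.A Fp] hm fst_F p by simp
  qed
  then show ?thesis using F fst_F by (simp add: qfunctor_def)
qed

end

lemma isomorphism_bij_betw:
  assumes "isomorphism Q C D F"
  shows "bij_betw F (Obj C) (Obj D)"
proof -
  obtain G where F: "F \<in> Obj C \<rightarrow>\<^sub>E Obj D" and G: "G \<in> Obj D \<rightarrow>\<^sub>E Obj C"
    and GF: "compose (Obj C) G F = id_functor C" and FG: "compose (Obj D) F G = id_functor D"
    using assms by (auto simp: isomorphism_def qfunctor_def)
  have "G (F x) = x" if "x \<in> Obj C" for x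
    using fun_cong[OF GF, of x] that by (simp add: compose_def id_functor_def)
  moreover have "F (G y) = y" if "y \<in> Obj D" for y
    using fun_cong[OF FG, of y] that by (simp add: compose_def id_functor_def)
  ultimately show ?thesis
    using F G by (intro bij_betw_byWitness[where f' = G]) auto
qed

section \<open>Restriction of the domain and of the codomain\<close>

lemma subcat_Obj [simp]: "subcat A (Obj A) = A"
  by (simp add: subcat_def)

lemma subcat_star [simp]: "subcat (star Q X) {()} = star Q X"
  by (simp add: subcat_def star_def)

lemma dist_restrict_dist_restrict [simp]:
  "dist_restrict (dist_restrict \<phi> S U) S' T = dist_restrict \<phi> (S \<inter> S') (U \<inter> T)"
  by (auto simp: dist_restrict_def Times_Int_Times)

lemma dist_restrict_apply [simp]: "\<lbrakk>x \<in> S; y \<in> T\<rbrakk> \<Longrightarrow> dist_restrict \<phi> S T (x, y) = \<phi> (x, y)"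
  by (simp add: dist_restrict_def)

definition psh_restrict :: "'x set \<Rightarrow> ('x, 'o, 'm) presheaf \<Rightarrow> ('x, 'o, 'm) presheaf" where
  "psh_restrict S p = (fst p, dist_restrict (snd p) S {()})"

text \<open>
  This is \<open>q \<circ> I\<^sup>\<natural>\<close>, the left Kan extension of a presheaf along the inclusion of \<open>S\<close>.
\<close>

definition psh_extend ::
    "('o, 'm) quantaloid \<Rightarrow> ('x, 'o, 'm) qcat \<Rightarrow> 'x set \<Rightarrow> ('x, 'o, 'm) presheaf \<Rightarrow> ('x, 'o, 'm) presheaf"
  where "psh_extend Q A S q =
    (fst q, dist_comp Q A (subcat A S) (star Q (fst q)) (snd q) (cograph (subcat A S) A (incl S)))"

lemma fst_psh_restrict [simp]: "fst (psh_restrict S p) = fst p"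
  by (simp add: psh_restrict_def)

lemma snd_psh_restrict [simp]: "x \<in> S \<Longrightarrow> snd (psh_restrict S p) (x, ()) = snd p (x, ())"
  by (simp add: psh_restrict_def)

lemma psh_restrict_in:
  assumes "p \<in> Obj (Psh Q A)" "S \<subseteq> Obj A" "quantaloid Q"
  shows "psh_restrict S p \<in> Obj (Psh Q (subcat A S))"
proof -
  interpret quantaloid Q by fact
  show ?thesis
    using distributor_restrict[of Q A "star Q (fst p)" "snd p" S "{()}"] assms
    by (simp add: Psh_iff psh_restrict_def)
qed

context qdistributor
begin

abbreviation dom_dist :: "'a set \<Rightarrow> 'a \<times> 'b \<Rightarrow> 'm" where
  "dom_dist S \<equiv> dist_restrict \<phi> S (Obj B)"

abbreviation cod_dist :: "'b set \<Rightarrow> 'a \<times> 'b \<Rightarrow> 'm" where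
  "cod_dist T \<equiv> dist_restrict \<phi> (Obj A) T"

abbreviation M_dom :: "'a set \<Rightarrow> (('a, 'o, 'm) presheaf, 'o, 'm) qcat" where
  "M_dom S \<equiv> M_cat Q (subcat A S) B (dom_dist S)"

abbreviation M_cod :: "'b set \<Rightarrow> (('a, 'o, 'm) presheaf, 'o, 'm) qcat" where
  "M_cod T \<equiv> M_cat Q A (subcat B T) (cod_dist T)"

abbreviation upper_dom :: "'a set \<Rightarrow> ('a, 'o, 'm) presheaf \<Rightarrow> ('b, 'o, 'm) copresheaf" where
  "upper_dom S \<equiv> up Q (subcat A S) B (dom_dist S)"

abbreviation lower_dom :: "'a set \<Rightarrow> ('b, 'o, 'm) copresheaf \<Rightarrow> ('a, 'o, 'm) presheaf" where
  "lower_dom S \<equiv> down Q (subcat A S) B (dom_dist S)"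

abbreviation upper_cod :: "'b set \<Rightarrow> ('a, 'o, 'm) presheaf \<Rightarrow> ('b, 'o, 'm) copresheaf" where
  "upper_cod T \<equiv> up Q A (subcat B T) (cod_dist T)"

abbreviation lower_cod :: "'b set \<Rightarrow> ('b, 'o, 'm) copresheaf \<Rightarrow> ('a, 'o, 'm) presheaf" where
  "lower_cod T \<equiv> down Q A (subcat B T) (cod_dist T)"

abbreviation closure_cod :: "'b set \<Rightarrow> ('a, 'o, 'm) presheaf \<Rightarrow> ('a, 'o, 'm) presheaf" where
  "closure_cod T p \<equiv> lower_cod T (upper_cod T p)"

lemma qdistributor_dom: "S \<subseteq> Obj A \<Longrightarrow> qdistributor Q (subcat A S) B (dom_dist S)"
  using distributor_restrict[OF \<phi>, of S "Obj B"] qcategory_subcat[OF A] B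
  by unfold_locales auto

lemma qdistributor_cod: "T \<subseteq> Obj B \<Longrightarrow> qdistributor Q A (subcat B T) (cod_dist T)"
  using distributor_restrict[OF \<phi>, of "Obj A" T] qcategory_subcat[OF B] A
  by unfold_locales auto

text \<open>
  This is \<open>\<phi> \<swarrow> (q \<circ> I\<^sup>\<natural>) = (\<phi> \<swarrow> I\<^sup>\<natural>) \<swarrow> q\<close> together with \<open>\<phi> \<swarrow> I\<^sup>\<natural> = \<phi>|S\<close>. An inequality that holds at the
  objects of \<open>S\<close> extends to all of \<open>A\<close> because \<open>A\<close> acts on \<open>\<phi>\<close>.
\<close>

lemma
  assumes S: "S \<subseteq> Obj A" and q: "q \<in> Obj (Psh Q (subcat A S))"
  shows psh_extend_in: "psh_extend Q A S q \<in> Obj (Psh Q A)"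
    and up_psh_extend: "upper (psh_extend Q A S q) = upper_dom S q"
proof -
  interpret S: qdistributor Q "subcat A S" B "dom_dist S" using qdistributor_dom[OF S] .
  let ?I = "cograph (subcat A S) A (incl S)" and ?e = "psh_extend Q A S q"
  note X = Psh_Ob[OF q]
  note star = qcategory_star[OF X]
  have I_dist: "distributor Q A (subcat A S) ?I"
  proof (rule distributorI[OF A S.A])
    show "?I \<in> extensional (Obj A \<times> Obj (subcat A S))" by (simp add: cograph_def)
  qed (use S in \<open>auto simp: cograph_def incl_def subset_iff
        intro: qcategory_hm[OF A] qcategory_trans[OF A]\<close>)
  have q_dist: "distributor Q (subcat A S) (star Q (fst q)) (snd q)" using q by (simp add: Psh_iff)
  show e: "?e \<in> Obj (Psh Q A)"
    using dist_comp_distributor[OF A S.A star I_dist q_dist] X by (simp add: Psh_iff psh_extend_def)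
  have fst_e: "fst ?e = fst q" by (simp add: psh_extend_def)
  have e_in: "snd ?e (x, ()) \<in> Hom Q (tp A x) (fst q)" if "x \<in> Obj A" for x
    using Psh_arrow[OF e that] fst_e by simp
  have q_in: "snd q (s, ()) \<in> Hom Q (tp A s) (fst q)" if "s \<in> S" for s
    using Psh_arrow[OF q, of s] that by simp
  have summand: "snd q (s, ()) \<circ>\<circ> hm A x s \<preceq> snd ?e (x, ())" if "x \<in> Obj A" "s \<in> S" for x s
    using dist_comp_le_iff[OF A S.A star I_dist q_dist that(1), of "()" "snd ?e (x, ())"] that e_in
      leq_refl[OF tpA[OF that(1)] X e_in[OF that(1)]] S
    by (auto simp: psh_extend_def cograph_def incl_def)
  show "upper ?e = upper_dom S q"
  proof (rule coPsh_eqI)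
    show "upper ?e \<in> Obj (coPsh Q B)" "upper_dom S q \<in> Obj (coPsh Q B)"
      using up_in[OF e] S.up_in[OF q] .
    show "fst (upper ?e) = fst (upper_dom S q)" using e q fst_e by simp
    fix y assume y: "y \<in> Obj B"
    note ty = tpB[OF y]
    have in_hom: "snd (upper ?e) ((), y) \<in> Hom Q (fst q) (tp B y)"
      using up_arrow[OF e y] fst_e by simp
    show "snd (upper ?e) ((), y) = snd (upper_dom S q) ((), y)"
    proof (rule arrow_eqI[OF X ty in_hom S.up_arrow[OF q y]])
      fix k assume k: "k \<in> Hom Q (fst q) (tp B y)"
      have "(\<forall>x \<in> Obj A. k \<circ>\<circ> snd ?e (x, ()) \<preceq> \<phi> (x, y)) \<longleftrightarrow> (\<forall>s \<in> S. k \<circ>\<circ> snd q (s, ()) \<preceq> \<phi> (s, y))"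
      proof (intro iffI ballI)
        fix s assume le: "\<forall>x \<in> Obj A. k \<circ>\<circ> snd ?e (x, ()) \<preceq> \<phi> (x, y)" and s: "s \<in> S"
        then have sA: "s \<in> Obj A" using S by auto
        note ts = tpA[OF sA] and ss = qcategory_hm[OF A sA sA]
        have "snd q (s, ()) \<circ>\<circ> ident Q (tp A s) \<preceq> snd q (s, ()) \<circ>\<circ> hm A s s"
          using cmp_mono_right[OF ts ts X ident_in[OF ts] ss q_in[OF s] qcategory_refl[OF A sA]] .
        then have "snd q (s, ()) \<preceq> snd q (s, ()) \<circ>\<circ> hm A s s"
          using ident_right[OF ts X q_in[OF s]] by simp
        then have "snd q (s, ()) \<preceq> snd ?e (s, ())"
          using leq_trans[OF ts X q_in[OF s] cmp_in[OF ts ts X ss q_in[OF s]] e_in[OF sA]]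
            summand[OF sA s] by blast
        then have "k \<circ>\<circ> snd q (s, ()) \<preceq> k \<circ>\<circ> snd ?e (s, ())"
          using cmp_mono_right[OF ts X ty q_in[OF s] e_in[OF sA] k] by blast
        then show "k \<circ>\<circ> snd q (s, ()) \<preceq> \<phi> (s, y)"
          using leq_trans[OF ts ty cmp_in[OF ts X ty q_in[OF s] k] cmp_in[OF ts X ty e_in[OF sA] k]
              \<phi>_in[OF sA y]] le sA by blast
      next
        fix x assume le: "\<forall>s \<in> S. k \<circ>\<circ> snd q (s, ()) \<preceq> \<phi> (s, y)" and x: "x \<in> Obj A"
        note tx = tpA[OF x]
        let ?F = "{snd q (s, ()) \<circ>\<circ> hm A x s | s. s \<in> S}"
        have F: "?F \<subseteq> Hom Q (tp A x) (fst q)"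
        proof
          fix f assume "f \<in> ?F"
          then obtain s where s: "s \<in> S" and f: "f = snd q (s, ()) \<circ>\<circ> hm A x s" by auto
          then have sA: "s \<in> Obj A" using S by auto
          show "f \<in> Hom Q (tp A x) (fst q)"
            unfolding f using cmp_in[OF tx tpA[OF sA] X qcategory_hm[OF A x sA] q_in[OF s]] .
        qed
        have "{snd q (s, ()) \<circ>\<circ> ?I (x, s) | s. s \<in> S} = ?F"
          using x by (auto simp: cograph_def incl_def)
        then have e_Join: "snd ?e (x, ()) = Join Q (tp A x) (fst q) ?F"
          using x by (simp add: psh_extend_def dist_comp_def)
        have "k \<circ>\<circ> snd ?e (x, ()) = Join Q (tp A x) (tp B y) {k \<circ>\<circ> f | f. f \<in> ?F}"
          unfolding e_Join using cmp_Join_right[OF tx X ty F k] .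
        also have "\<dots> \<preceq> \<phi> (x, y)"
        proof (rule Join_least[OF tx ty _ \<phi>_in[OF x y]])
          show "{k \<circ>\<circ> f | f. f \<in> ?F} \<subseteq> Hom Q (tp A x) (tp B y)"
            using cmp_in[OF tx X ty _ k] F by blast
          fix h assume "h \<in> {k \<circ>\<circ> f | f. f \<in> ?F}"
          then obtain s where s: "s \<in> S" and h: "h = k \<circ>\<circ> (snd q (s, ()) \<circ>\<circ> hm A x s)" by auto
          have sA: "s \<in> Obj A" using s S by auto
          note ts = tpA[OF sA] and xs = qcategory_hm[OF A x sA]
          note kq = cmp_in[OF ts X ty q_in[OF s] k]
          have h': "h = (k \<circ>\<circ> snd q (s, ())) \<circ>\<circ> hm A x s"
            unfolding h using cmp_assoc[OF tx ts X ty xs q_in[OF s] k] .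
          have "h \<preceq> \<phi> (s, y) \<circ>\<circ> hm A x s"
            unfolding h' using cmp_mono_left[OF tx ts ty xs kq \<phi>_in[OF sA y]] le s by blast
          then show "h \<preceq> \<phi> (x, y)"
            using leq_trans[OF tx ty _ cmp_in[OF tx ts ty xs \<phi>_in[OF sA y]] \<phi>_in[OF x y]]
              distributor_act_right[OF A B \<phi> sA x y] cmp_in[OF tx ts ty xs kq] h' by blast
        qed
        finally show "k \<circ>\<circ> snd ?e (x, ()) \<preceq> \<phi> (x, y)" .
      qed
      then show "k \<preceq> snd (upper ?e) ((), y) \<longleftrightarrow> k \<preceq> snd (upper_dom S q) ((), y)"
        using le_up_iff[OF e y] S.le_up_iff[OF q y k] k fst_e y by simp
    qed
  qed
qed

end

context qdistributor
begin

lemma closure_mono: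
  assumes p: "p \<in> Obj (Psh Q A)" and p': "p' \<in> Obj (Psh Q A)" and g: "g \<in> Hom Q (fst p) (fst p')"
    and le: "\<And>x. x \<in> Obj A \<Longrightarrow> g \<circ>\<circ> snd p (x, ()) \<preceq> snd p' (x, ())"
    and x: "x \<in> Obj A"
  shows "g \<circ>\<circ> snd (closure p) (x, ()) \<preceq> snd (closure p') (x, ())"
  using down_antitone[OF up_in[OF p] up_in[OF p'] _ _ x] up_antitone[OF p p' g le] g p p' by simp

lemma up_cod:
  assumes T: "T \<subseteq> Obj B" and p: "p \<in> Obj (Psh Q A)" and y: "y \<in> T"
  shows "snd (upper_cod T p) ((), y) = snd (upper p) ((), y)"
proof -
  interpret T: qdistributor Q A "subcat B T" "cod_dist T" using qdistributor_cod[OF T] .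
  have yB: "y \<in> Obj B" using T y by auto
  have in_hom: "snd (upper_cod T p) ((), y) \<in> Hom Q (fst p) (tp B y)"
    using T.up_arrow[OF p, of y] y by simp
  show ?thesis
    by (rule arrow_eqI[OF Psh_Ob[OF p] tpB[OF yB] in_hom up_arrow[OF p yB]])
      (use le_up_iff[OF p yB] T.le_up_iff[OF p, of y] y in simp)
qed

text \<open>
  Fewer objects in the codomain impose fewer conditions on the lower presheaf, so they give a larger
  closure.
\<close>

lemma closure_le_closure_cod:
  assumes T: "T \<subseteq> Obj B" and p: "p \<in> Obj (Psh Q A)" and x: "x \<in> Obj A"
  shows "snd (closure p) (x, ()) \<preceq> snd (closure_cod T p) (x, ())"
proof -
  interpret T: qdistributor Q A "subcat B T" "cod_dist T" using qdistributor_cod[OF T] .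
  have "snd (upper_cod T p) ((), y) \<circ>\<circ> snd (closure p) (x, ()) \<preceq> cod_dist T (x, y)" if "y \<in> T" for y
    using up_cod[OF T p that] down_eval[OF up_in[OF p] x, of y] that T x by auto
  then show ?thesis
    using T.le_down_iff[OF T.up_in[OF p] x] Psh_arrow[OF closure_in[OF p] x] p by simp
qed

lemma M_cod_subset:
  assumes T: "T \<subseteq> Obj B"
  shows "Obj (M_cod T) \<subseteq> Obj M"
proof
  interpret T: qdistributor Q A "subcat B T" "cod_dist T" using qdistributor_cod[OF T] .
  fix p assume "p \<in> Obj (M_cod T)"
  then have p: "p \<in> Obj (Psh Q A)" and closed: "closure_cod T p = p" by (simp_all add: T.Obj_M_iff)
  have "closure p = p"
  proof (rule Psh_eqI[OF closure_in[OF p] p])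
    show "fst (closure p) = fst p" using p by simp
    fix x assume x: "x \<in> Obj A"
    show "snd (closure p) (x, ()) = snd p (x, ())"
      using leq_antisym[OF tpA[OF x] Psh_Ob[OF p] _ Psh_arrow[OF p x]] Psh_arrow[OF closure_in[OF p] x]
        closure_le_closure_cod[OF T p x] closed le_closure[OF p x] p by simp
  qed
  then show "p \<in> Obj M" using p by (simp add: Obj_M_iff)
qed

text \<open>
  The identity distributor of \<open>A\<close> is the cograph of the inclusion of \<open>Obj A\<close> into \<open>A\<close>, so composition with it is
  the extension from the full subset \<open>Obj A\<close>, and \<open>up_psh_extend\<close> applies.
\<close>

lemma M_A_J_eq:
  assumes T: "T \<subseteq> Obj B"
  shows "M_A_J Q A B \<phi> T = (\<lambda>p \<in> Obj M. closure_cod T p)"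
proof
  interpret T: qdistributor Q A "subcat B T" "cod_dist T" using qdistributor_cod[OF T] .
  have id: "id_dist A = cograph (subcat A (Obj A)) A (incl (Obj A))"
    by (auto simp: id_dist_def cograph_def incl_def)
  fix p
  have "upper_cod T (psh_extend Q A (Obj A) p) = upper_cod T p" if "p \<in> Obj M"
    using T.up_psh_extend[OF subset_refl, of p] M_Psh[OF that] by simp
  then show "M_A_J Q A B \<phi> T p = (\<lambda>p \<in> Obj M. closure_cod T p) p"
    by (simp add: M_A_J_def M_map_def case_prod_unfold id psh_extend_def)
qed

lemma adjunction_M_A_J:
  assumes T: "T \<subseteq> Obj B"
  shows "adjunction Q M (M_cod T) (M_A_J Q A B \<phi> T) (\<lambda>p \<in> Obj (M_cod T). p)"
proof -
  interpret T: qdistributor Q A "subcat B T" "cod_dist T" using qdistributor_cod[OF T] .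
  let ?F = "\<lambda>p \<in> Obj M. closure_cod T p" and ?G = "\<lambda>p \<in> Obj (M_cod T). p"
  have closed: "closure_cod T p \<in> Obj (M_cod T)" if "p \<in> Obj M" for p
    using T.down_in_M[OF T.up_in[OF M_Psh[OF that]]] .
  have G_in: "p \<in> Obj M" if "p \<in> Obj (M_cod T)" for p using M_cod_subset[OF T] that by auto
  have F: "qfunctor Q M (M_cod T) ?F"
    by (rule M_functorI[OF qdistributor_axioms T.qdistributor_axioms])
      (use closed T.closure_mono M_Psh in auto)
  have G: "qfunctor Q (M_cod T) M ?G"
    by (rule M_functorI[OF T.qdistributor_axioms qdistributor_axioms]) (use G_in in auto)
  have "functor_le Q M M (id_functor M) (compose (Obj M) ?G ?F)"
    using underlying_le_M_iff closed G_in T.le_closure M_Psh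
    by (simp add: functor_le_def id_functor_def compose_def)
  moreover have "functor_le Q (M_cod T) (M_cod T) (compose (Obj (M_cod T)) ?F ?G) (id_functor (M_cod T))"
    using T.underlying_le_M_iff T.M_closure G_in
      leq_refl[OF tpA Psh_Ob[OF T.M_Psh] Psh_arrow[OF T.M_Psh]]
    by (simp add: functor_le_def id_functor_def compose_def)
  ultimately show ?thesis using F G M_A_J_eq[OF T] by (simp add: adjunction_def)
qed

lemma right_adjoint_M_A_J:
  assumes T: "T \<subseteq> Obj B"
  shows "right_adjoint Q M (M_cod T) (M_A_J Q A B \<phi> T) = (\<lambda>p \<in> Obj (M_cod T). p)"
proof -
  interpret T: qdistributor Q A "subcat B T" "cod_dist T" using qdistributor_cod[OF T] .
  show ?thesis
    using right_adjoint_eqI[OF qcategory_M T.qcategory_M M_skeletal adjunction_M_A_J[OF T]] .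
qed

lemma M_I_B_eq:
  assumes S: "S \<subseteq> Obj A"
  shows "M_I_B Q A B \<phi> S = (\<lambda>q \<in> Obj (M_dom S). lower (upper_dom S q))"
proof
  interpret S: qdistributor Q "subcat A S" B "dom_dist S" using qdistributor_dom[OF S] .
  fix q
  have "upper (psh_extend Q A S q) = upper_dom S q" if "q \<in> Obj (M_dom S)"
    using up_psh_extend[OF S S.M_Psh[OF that]] .
  then show "M_I_B Q A B \<phi> S q = (\<lambda>q \<in> Obj (M_dom S). lower (upper_dom S q)) q"
    by (simp add: M_I_B_def M_map_def case_prod_unfold psh_extend_def)
qed

text \<open>
  The value of \<open>\<kappa> \<searrow> \<phi>\<close> at an object \<open>x\<close> involves \<open>\<phi>\<close> only at that \<open>x\<close>.
\<close>

lemma restrict_down: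
  assumes S: "S \<subseteq> Obj A" and k: "k \<in> Obj (coPsh Q B)"
  shows "psh_restrict S (lower k) = lower_dom S k"
proof -
  interpret S: qdistributor Q "subcat A S" B "dom_dist S" using qdistributor_dom[OF S] .
  show ?thesis
  proof (rule Psh_eqI)
    show "psh_restrict S (lower k) \<in> Obj (Psh Q (subcat A S))"
      using psh_restrict_in[OF down_in[OF k] S quantaloid_axioms] .
    show "lower_dom S k \<in> Obj (Psh Q (subcat A S))" using S.down_in[OF k] .
    show "fst (psh_restrict S (lower k)) = fst (lower_dom S k)" using k by simp
    fix x assume "x \<in> Obj (subcat A S)"
    then have x: "x \<in> S" "x \<in> Obj A" using S by auto
    have in_hom: "snd (lower_dom S k) (x, ()) \<in> Hom Q (tp A x) (fst k)"
      using S.down_arrow[OF k, of x] x by simp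
    have "snd (lower k) (x, ()) = snd (lower_dom S k) (x, ())"
      by (rule arrow_eqI[OF tpA[OF x(2)] coPsh_Ob[OF k] down_arrow[OF k x(2)] in_hom])
        (use le_down_iff[OF k x(2)] S.le_down_iff[OF k, of x] x in simp)
    then show "snd (psh_restrict S (lower k)) (x, ()) = snd (lower_dom S k) (x, ())"
      using x by simp
  qed
qed

lemma restrict_in_M_dom:
  assumes S: "S \<subseteq> Obj A" and p: "p \<in> Obj M"
  shows "psh_restrict S p \<in> Obj (M_dom S)"
proof -
  interpret S: qdistributor Q "subcat A S" B "dom_dist S" using qdistributor_dom[OF S] .
  show ?thesis
    using S.down_in_M[OF up_in[OF M_Psh[OF p]]] restrict_down[OF S up_in[OF M_Psh[OF p]]]
      M_closure[OF p] by simp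
qed

lemma restrict_extend:
  assumes S: "S \<subseteq> Obj A" and q: "q \<in> Obj (M_dom S)"
  shows "psh_restrict S (lower (upper_dom S q)) = q"
proof -
  interpret S: qdistributor Q "subcat A S" B "dom_dist S" using qdistributor_dom[OF S] .
  show ?thesis using restrict_down[OF S S.up_in[OF S.M_Psh[OF q]]] S.M_closure[OF q] by simp
qed

lemma extend_in_M:
  assumes S: "S \<subseteq> Obj A" and q: "q \<in> Obj (M_dom S)"
  shows "lower (upper_dom S q) \<in> Obj M"
proof -
  interpret S: qdistributor Q "subcat A S" B "dom_dist S" using qdistributor_dom[OF S] .
  show ?thesis using down_in_M[OF S.up_in[OF S.M_Psh[OF q]]] .
qed

text \<open>
  The inequalities that define the upper copresheaf of \<open>p|S\<close> are some of those for \<open>p\<close>, so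
  passing to \<open>p|S\<close> enlarges the upper copresheaf and shrinks its lower presheaf. This is the counit of the coreflection.
\<close>

lemma extend_restrict_le:
  assumes S: "S \<subseteq> Obj A" and p: "p \<in> Obj M" and x: "x \<in> Obj A"
  shows "snd (lower (upper_dom S (psh_restrict S p))) (x, ()) \<preceq> snd p (x, ())"
proof -
  interpret S: qdistributor Q "subcat A S" B "dom_dist S" using qdistributor_dom[OF S] .
  let ?q = "psh_restrict S p"
  note pP = M_Psh[OF p] and q = S.M_Psh[OF restrict_in_M_dom[OF S p]]
  note X = Psh_Ob[OF pP]
  note k = up_in[OF pP] and k' = S.up_in[OF q]
  have "snd (upper p) ((), y) \<preceq> snd (upper_dom S ?q) ((), y)" if y: "y \<in> Obj B" for y
  proof -
    have "snd (upper p) ((), y) \<circ>\<circ> snd p (s, ()) \<preceq> \<phi> (s, y)" if "s \<in> S" for s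
      using up_eval[OF pP _ y] S that by auto
    then show ?thesis using S.le_up_iff[OF q y] up_arrow[OF pP y] y by simp
  qed
  then have "ident Q (fst p) \<circ>\<circ> snd (lower (upper_dom S ?q)) (x, ()) \<preceq> snd (lower (upper p)) (x, ())"
    using down_antitone[OF k' k _ _ x, of "ident Q (fst p)"] ident_in[OF X] pP q
      ident_right[OF X tpB up_arrow[OF pP]] by simp
  then show ?thesis
    using ident_left[OF tpA[OF x] X, of "snd (lower (upper_dom S ?q)) (x, ())"] down_arrow[OF k' x] q
      M_closure[OF p] by simp
qed

lemma adjunction_M_I_B:
  assumes S: "S \<subseteq> Obj A"
  shows "adjunction Q (M_dom S) M (M_I_B Q A B \<phi> S) (\<lambda>p \<in> Obj M. psh_restrict S p)"
proof -
  interpret S: qdistributor Q "subcat A S" B "dom_dist S" using qdistributor_dom[OF S] .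
  let ?F = "\<lambda>q \<in> Obj (M_dom S). lower (upper_dom S q)" and ?G = "\<lambda>p \<in> Obj M. psh_restrict S p"
  have fst_F: "fst (lower (upper_dom S q)) = fst q" if "q \<in> Obj (M_dom S)" for q
    using S.M_Psh[OF that] S.up_in[OF S.M_Psh[OF that]] by simp
  have F: "qfunctor Q (M_dom S) M ?F"
  proof (rule M_functorI[OF S.qdistributor_axioms qdistributor_axioms])
    show "?F \<in> Obj (M_dom S) \<rightarrow>\<^sub>E Obj M" using extend_in_M[OF S] by auto
    show "fst (?F q) = fst q" if "q \<in> Obj (M_dom S)" for q using fst_F that by simp
    fix q q' g x
    assume q: "q \<in> Obj (M_dom S)" "q' \<in> Obj (M_dom S)" and g: "g \<in> Hom Q (fst q) (fst q')"
      and le: "\<And>x. x \<in> Obj (subcat A S) \<Longrightarrow> g \<circ>\<circ> snd q (x, ()) \<preceq> snd q' (x, ())" and x: "x \<in> Obj A"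
    note qP = S.M_Psh[OF q(1)] S.M_Psh[OF q(2)]
    show "g \<circ>\<circ> snd (?F q) (x, ()) \<preceq> snd (?F q') (x, ())"
      using down_antitone[OF S.up_in[OF qP(1)] S.up_in[OF qP(2)] _ S.up_antitone[OF qP g le] x] g q qP
      by simp
  qed
  have G: "qfunctor Q M (M_dom S) ?G"
    by (rule M_functorI[OF qdistributor_axioms S.qdistributor_axioms])
      (use restrict_in_M_dom[OF S] S in auto)
  have "functor_le Q (M_dom S) (M_dom S) (id_functor (M_dom S)) (compose (Obj (M_dom S)) ?G ?F)"
    using S.underlying_le_M_iff S.le_closure S.M_Psh S.M_closure extend_in_M[OF S] restrict_extend[OF S]
    by (fastforce simp: functor_le_def id_functor_def compose_def)
  moreover have "functor_le Q M M (compose (Obj M) ?F ?G) (id_functor M)"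
    using underlying_le_M_iff extend_in_M[OF S] restrict_in_M_dom[OF S] extend_restrict_le[OF S] fst_F
    by (simp add: functor_le_def id_functor_def compose_def)
  ultimately show ?thesis using F G M_I_B_eq[OF S] by (simp add: adjunction_def)
qed

lemma right_adjoint_M_I_B:
  assumes S: "S \<subseteq> Obj A"
  shows "right_adjoint Q (M_dom S) M (M_I_B Q A B \<phi> S) = (\<lambda>p \<in> Obj M. psh_restrict S p)"
proof -
  interpret S: qdistributor Q "subcat A S" B "dom_dist S" using qdistributor_dom[OF S] .
  show ?thesis
    using right_adjoint_eqI[OF S.qcategory_M qcategory_M S.M_skeletal adjunction_M_I_B[OF S]] .
qed

section \<open>Reducibility\<close>

lemma reducible_dom_iff_up:
  assumes S: "S \<subseteq> Obj A"
  shows "reducible_dom Q A B \<phi> (Obj A - S) \<longleftrightarrow>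
    (\<forall>p \<in> Obj (Psh Q A). \<exists>q \<in> Obj (Psh Q (subcat A S)). upper p = upper_dom S q)"
proof -
  interpret S: qdistributor Q "subcat A S" B "dom_dist S" using qdistributor_dom[OF S] .
  have "(\<exists>\<mu>'. (X, \<mu>') \<in> Obj (Psh Q (subcat A S)) \<and> dist_limp Q A (star Q X) B \<phi> \<mu> =
        dist_limp Q (subcat A S) (star Q X) B (dom_dist S) \<mu>') \<longleftrightarrow>
      (\<exists>q \<in> Obj (Psh Q (subcat A S)). upper (X, \<mu>) = upper_dom S q)"
    if p: "(X, \<mu>) \<in> Obj (Psh Q A)" for X \<mu>
    using up_eq[OF p] S.up_eq[of "(_, _)"] by (simp add: Bex_def split_paired_Ex cong: conj_cong)
  then show ?thesis
    unfolding reducible_dom_def Let_def double_diff[OF S subset_refl] by auto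
qed

text \<open>
  If the upper copresheaf of \<open>p\<close> comes from some \<open>q\<close> on \<open>S\<close>, then it also comes from \<open>p|S\<close>, which is the
  closure of \<open>q\<close>; so a closed \<open>p\<close> is recovered from \<open>p|S\<close>. Conversely, \<open>p\<close> and its closure have the
  same upper copresheaf, and the closure agrees with the extension of its restriction, since these
  two closed presheaves have the same restriction.
\<close>

lemma reducible_dom_iff_inj:
  assumes S: "S \<subseteq> Obj A"
  shows "reducible_dom Q A B \<phi> (Obj A - S) \<longleftrightarrow> inj_on (psh_restrict S) (Obj M)"
proof
  interpret S: qdistributor Q "subcat A S" B "dom_dist S" using qdistributor_dom[OF S] .
  assume red: "reducible_dom Q A B \<phi> (Obj A - S)"
  have "lower (upper_dom S (psh_restrict S p)) = p" if p: "p \<in> Obj M" for p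
  proof -
    obtain q where q: "q \<in> Obj (Psh Q (subcat A S))" and eq: "upper p = upper_dom S q"
      using red M_Psh[OF p] reducible_dom_iff_up[OF S] by blast
    have "psh_restrict S p = lower_dom S (upper_dom S q)"
      using restrict_down[OF S up_in[OF M_Psh[OF p]]] M_closure[OF p] eq by simp
    then have "upper_dom S (psh_restrict S p) = upper p" using S.up_closure[OF q] eq by simp
    then show ?thesis using M_closure[OF p] by simp
  qed
  then show "inj_on (psh_restrict S) (Obj M)" by (rule inj_on_inverseI)
next
  interpret S: qdistributor Q "subcat A S" B "dom_dist S" using qdistributor_dom[OF S] .
  assume inj: "inj_on (psh_restrict S) (Obj M)"
  have "\<exists>q \<in> Obj (Psh Q (subcat A S)). upper p = upper_dom S q" if p: "p \<in> Obj (Psh Q A)" for p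
  proof
    let ?q = "psh_restrict S (closure p)"
    have c: "closure p \<in> Obj M" using down_in_M[OF up_in[OF p]] .
    have q: "?q \<in> Obj (M_dom S)" using restrict_in_M_dom[OF S c] .
    show "?q \<in> Obj (Psh Q (subcat A S))" using S.M_Psh[OF q] .
    note e = up_psh_extend[OF S S.M_Psh[OF q]]
    have "lower (upper_dom S ?q) = closure p"
      using inj_onD[OF inj restrict_extend[OF S q] extend_in_M[OF S q] c] .
    then have "upper p = upper (closure (psh_extend Q A S ?q))" using e up_closure[OF p] by simp
    also have "\<dots> = upper_dom S ?q" using up_closure[OF psh_extend_in[OF S S.M_Psh[OF q]]] e by simp
    finally show "upper p = upper_dom S ?q" .
  qed
  then show "reducible_dom Q A B \<phi> (Obj A - S)" using reducible_dom_iff_up[OF S] by blast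
qed

text \<open>
  The closed presheaves are exactly the values of the lower operator, so reducibility compares the
  values of two lower operators.
\<close>

lemma reducible_cod_iff_subset:
  assumes T: "T \<subseteq> Obj B"
  shows "reducible_cod Q A B \<phi> (Obj B - T) \<longleftrightarrow> Obj M \<subseteq> Obj (M_cod T)"
proof -
  interpret T: qdistributor Q A "subcat B T" "cod_dist T" using qdistributor_cod[OF T] .
  have "(\<exists>\<kappa>'. (X, \<kappa>') \<in> Obj (coPsh Q (subcat B T)) \<and> dist_rimp Q A (star Q X) B \<kappa> \<phi> =
        dist_rimp Q A (star Q X) (subcat B T) \<kappa>' (cod_dist T)) \<longleftrightarrow>
      (\<exists>k' \<in> Obj (coPsh Q (subcat B T)). lower (X, \<kappa>) = lower_cod T k')"
    if k: "(X, \<kappa>) \<in> Obj (coPsh Q B)" for X \<kappa>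
    using down_eq[OF k] T.down_eq[of "(_, _)"] by (simp add: Bex_def split_paired_Ex cong: conj_cong)
  then have "reducible_cod Q A B \<phi> (Obj B - T) \<longleftrightarrow>
      (\<forall>k \<in> Obj (coPsh Q B). \<exists>k' \<in> Obj (coPsh Q (subcat B T)). lower k = lower_cod T k')"
    unfolding reducible_cod_def Let_def double_diff[OF T subset_refl] by auto
  also have "\<dots> \<longleftrightarrow> Obj M \<subseteq> Obj (M_cod T)"
  proof
    assume red: "\<forall>k \<in> Obj (coPsh Q B). \<exists>k' \<in> Obj (coPsh Q (subcat B T)). lower k = lower_cod T k'"
    show "Obj M \<subseteq> Obj (M_cod T)"
    proof
      fix p assume p: "p \<in> Obj M"
      obtain k' where "k' \<in> Obj (coPsh Q (subcat B T))" "closure p = lower_cod T k'"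
        using red up_in[OF M_Psh[OF p]] by blast
      then show "p \<in> Obj (M_cod T)" using T.down_in_M M_closure[OF p] by metis
    qed
  next
    assume sub: "Obj M \<subseteq> Obj (M_cod T)"
    show "\<forall>k \<in> Obj (coPsh Q B). \<exists>k' \<in> Obj (coPsh Q (subcat B T)). lower k = lower_cod T k'"
    proof
      fix k assume k: "k \<in> Obj (coPsh Q B)"
      have d: "lower k \<in> Obj (M_cod T)" using sub down_in_M[OF k] by auto
      show "\<exists>k' \<in> Obj (coPsh Q (subcat B T)). lower k = lower_cod T k'"
        using T.up_in[OF T.M_Psh[OF d]] T.M_closure[OF d] by metis
    qed
  qed
  finally show ?thesis .
qed

end

section \<open>The comparison functors\<close>

locale subcategories = qdistributor Q A B \<phi>
  for Q :: "('o, 'm) quantaloid" (structure) and A :: "('a, 'o, 'm) qcat"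
    and B :: "('b, 'o, 'm) qcat" and \<phi> :: "'a \<times> 'b \<Rightarrow> 'm" +
  fixes S :: "'a set" and T :: "'b set"
  assumes S_subset: "S \<subseteq> Obj A" and T_subset: "T \<subseteq> Obj B"

sublocale subcategories \<subseteq> S: qdistributor Q "subcat A S" B "dist_restrict \<phi> S (Obj B)"
  by (rule qdistributor_dom[OF S_subset])

sublocale subcategories \<subseteq> T: qdistributor Q A "subcat B T" "dist_restrict \<phi> (Obj A) T"
  by (rule qdistributor_cod[OF T_subset])

sublocale subcategories \<subseteq> ST: qdistributor Q "subcat A S" "subcat B T" "dist_restrict \<phi> S T"
  using S.qdistributor_cod[OF T_subset] T_subset by (simp add: Int_absorb1)

context subcategories
begin

lemma S_cod_dist: "S.cod_dist T = dist_restrict \<phi> S T"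
  and T_dom_dist: "T.dom_dist S = dist_restrict \<phi> S T"
  using S_subset T_subset by (simp_all add: Int_absorb1)

lemma M_A'_J_eq: "M_A'_J Q A B \<phi> S T = M_A_J Q (subcat A S) B (dom_dist S) T"
  using S_cod_dist by (simp add: M_A'_J_def M_A_J_def)

lemma M_I_B'_eq: "M_I_B' Q A B \<phi> S T = M_I_B Q A (subcat B T) (cod_dist T) S"
  using T_dom_dist by (simp add: M_I_B'_def M_I_B_def)

lemma ST_M_subset: "Obj ST.M \<subseteq> Obj S.M"
  using S.M_cod_subset[OF T_subset] unfolding S_cod_dist .

lemma restrict_in_ST: "p \<in> Obj T.M \<Longrightarrow> psh_restrict S p \<in> Obj ST.M"
  using T.restrict_in_M_dom[OF S_subset] unfolding T_dom_dist .

lemma extend_in_T: "q \<in> Obj ST.M \<Longrightarrow> T.lower (ST.upper q) \<in> Obj T.M"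
  using T.extend_in_M[OF S_subset] unfolding T_dom_dist .

lemma restrict_extend_T: "q \<in> Obj ST.M \<Longrightarrow> psh_restrict S (T.lower (ST.upper q)) = q"
  using T.restrict_extend[OF S_subset] unfolding T_dom_dist .

lemma adjunction_ST_T:
  "adjunction Q ST.M T.M (M_I_B' Q A B \<phi> S T) (\<lambda>p \<in> Obj T.M. psh_restrict S p)"
  using T.adjunction_M_I_B[OF S_subset] unfolding T_dom_dist M_I_B'_eq .

lemma R1_apply: "p \<in> Obj M \<Longrightarrow> R1 Q A B \<phi> S T p = ST.closure (psh_restrict S p)"
  using right_adjoint_M_I_B[OF S_subset] S.M_A_J_eq[OF T_subset] restrict_in_M_dom[OF S_subset]
  unfolding S_cod_dist by (simp add: R1_def M_A'_J_eq compose_def)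

lemma R2_apply: "p \<in> Obj M \<Longrightarrow> R2 Q A B \<phi> S T p = psh_restrict S (T.closure p)"
  using T.right_adjoint_M_I_B[OF S_subset] M_A_J_eq[OF T_subset] T.down_in_M[OF T.up_in[OF M_Psh]]
  unfolding T_dom_dist by (simp add: R2_def M_I_B'_eq compose_def)

lemma E1_apply: "q \<in> Obj ST.M \<Longrightarrow> E1 Q A B \<phi> S T q = lower (S.upper q)"
  using S.right_adjoint_M_A_J[OF T_subset] M_I_B_eq[OF S_subset] ST_M_subset
  unfolding S_cod_dist by (auto simp: E1_def M_A'_J_eq compose_def)

lemma E2_eq: "E2 Q A B \<phi> S T = (\<lambda>q \<in> Obj ST.M. T.lower (ST.upper q))"
  using right_adjoint_M_A_J[OF T_subset] T.M_I_B_eq[OF S_subset] extend_in_T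
  unfolding T_dom_dist by (auto simp: E2_def M_I_B'_eq compose_def)

text \<open>
  The witness is \<open>L\<^sub>T(p|S)\<close>: it lies in \<open>M\<^sub>T \<subseteq> M\<close> and has the same restriction as \<open>p\<close>.
\<close>

lemma M_subset_T_M:
  assumes inj: "inj_on (psh_restrict S) (Obj M)"
    and closed: "\<And>p. p \<in> Obj M \<Longrightarrow> psh_restrict S p \<in> Obj ST.M"
  shows "Obj M \<subseteq> Obj T.M"
proof
  fix p assume p: "p \<in> Obj M"
  let ?p' = "T.lower (ST.upper (psh_restrict S p))"
  have p': "?p' \<in> Obj T.M" using extend_in_T closed[OF p] .
  have "psh_restrict S ?p' = psh_restrict S p" using restrict_extend_T closed[OF p] .
  then have "?p' = p" using inj_onD[OF inj] p p' M_cod_subset[OF T_subset] by blast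
  then show "p \<in> Obj T.M" using p' by simp
qed

text \<open>
  Injectivity of \<open>R\<^sub>1\<close> passes to its first factor, restriction, which is onto \<open>M\<^sub>S\<close>. So \<open>ST\<close>-closure
  is injective on \<open>M\<^sub>S\<close>; being idempotent, it fixes every restriction \<open>p|S\<close>, which then lies in
  \<open>M\<^sub>S\<^sub>T\<close>.
\<close>

lemma reducible_if_R1_inj:
  assumes inj: "inj_on (R1 Q A B \<phi> S T) (Obj M)"
  shows "inj_on (psh_restrict S) (Obj M)" and "Obj M \<subseteq> Obj T.M"
proof -
  show inj_r: "inj_on (psh_restrict S) (Obj M)"
    using inj by (auto simp: inj_on_def R1_apply)
  have "psh_restrict S p \<in> Obj ST.M" if p: "p \<in> Obj M" for p
  proof -
    let ?q = "ST.closure (psh_restrict S p)"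
    have r: "psh_restrict S p \<in> Obj (Psh Q (subcat A S))"
      using S.M_Psh[OF restrict_in_M_dom[OF S_subset p]] .
    have q: "?q \<in> Obj ST.M" using ST.down_in_M[OF ST.up_in[OF r]] .
    then have qS: "?q \<in> Obj S.M" using ST_M_subset by blast
    note p' = extend_in_M[OF S_subset qS] and r' = restrict_extend[OF S_subset qS]
    \<comment> \<open>\<open>L ?q\<close> restricts to the closure \<open>?q\<close> of \<open>p|S\<close>, so \<open>R\<^sub>1\<close> does not separate it from \<open>p\<close>.\<close>
    have "R1 Q A B \<phi> S T (lower (S.upper ?q)) = R1 Q A B \<phi> S T p"
      using R1_apply[OF p] R1_apply[OF p'] r' ST.M_closure[OF q] by simp
    then have "lower (S.upper ?q) = p" using inj_onD[OF inj _ p' p] by blast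
    then show ?thesis using r' q by simp
  qed
  then show "Obj M \<subseteq> Obj T.M" using M_subset_T_M[OF inj_r] by blast
qed

text \<open>
  An injective composite forces its first factor, the idempotent \<open>T\<close>-closure, to be the identity on \<open>M\<close>.
\<close>

lemma reducible_if_R2_inj:
  assumes inj: "inj_on (R2 Q A B \<phi> S T) (Obj M)"
  shows "inj_on (psh_restrict S) (Obj M)" and "Obj M \<subseteq> Obj T.M"
proof -
  show sub: "Obj M \<subseteq> Obj T.M"
  proof
    fix p assume p: "p \<in> Obj M"
    have c: "T.closure p \<in> Obj T.M" using T.down_in_M[OF T.up_in[OF M_Psh[OF p]]] .
    then have c': "T.closure p \<in> Obj M" using M_cod_subset[OF T_subset] by blast
    have "R2 Q A B \<phi> S T (T.closure p) = R2 Q A B \<phi> S T p"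
      using R2_apply[OF p] R2_apply[OF c'] T.M_closure[OF c] by simp
    then show "p \<in> Obj T.M" using inj_onD[OF inj _ c' p] c by simp
  qed
  have "R2 Q A B \<phi> S T p = psh_restrict S p" if p: "p \<in> Obj M" for p
    using R2_apply[OF p] T.M_closure[OF subsetD[OF sub p]] by simp
  then show "inj_on (psh_restrict S) (Obj M)"
    using inj inj_on_cong[of "Obj M" "R2 Q A B \<phi> S T" "psh_restrict S"] by blast
qed

text \<open>
  Each \<open>p\<close> in \<open>M\<close> is \<open>L q\<close> with \<open>q\<close> in \<open>M\<^sub>S\<^sub>T\<close>, and \<open>q\<close> is then the restriction of \<open>p\<close>.
\<close>

lemma reducible_if_E1_surj:
  assumes surj: "E1 Q A B \<phi> S T ` Obj ST.M = Obj M"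
  shows "inj_on (psh_restrict S) (Obj M)" and "Obj M \<subseteq> Obj T.M"
proof -
  have ex: "\<exists>q \<in> Obj ST.M. p = lower (S.upper q) \<and> psh_restrict S p = q" if "p \<in> Obj M" for p
  proof -
    obtain q where q: "q \<in> Obj ST.M" and p: "p = E1 Q A B \<phi> S T q"
      using \<open>p \<in> Obj M\<close> surj by blast
    then show ?thesis
      using E1_apply[OF q] restrict_extend[OF S_subset subsetD[OF ST_M_subset q]] by auto
  qed
  show inj: "inj_on (psh_restrict S) (Obj M)"
  proof (rule inj_onI)
    fix p p' assume "p \<in> Obj M" "p' \<in> Obj M" "psh_restrict S p = psh_restrict S p'"
    then show "p = p'" using ex[of p] ex[of p'] by auto
  qed
  show "Obj M \<subseteq> Obj T.M" using M_subset_T_M[OF inj] ex by blast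
qed

lemma reducible_if_E2_surj:
  assumes surj: "E2 Q A B \<phi> S T ` Obj ST.M = Obj M"
  shows "inj_on (psh_restrict S) (Obj M)" and "Obj M \<subseteq> Obj T.M"
proof -
  have ex: "\<exists>q \<in> Obj ST.M. p = T.lower (ST.upper q) \<and> psh_restrict S p = q" if "p \<in> Obj M" for p
  proof -
    obtain q where q: "q \<in> Obj ST.M" and p: "p = E2 Q A B \<phi> S T q"
      using \<open>p \<in> Obj M\<close> surj by blast
    then show ?thesis using E2_eq restrict_extend_T[OF q] by auto
  qed
  then show "Obj M \<subseteq> Obj T.M" using extend_in_T by blast
  show "inj_on (psh_restrict S) (Obj M)"
  proof (rule inj_onI)
    fix p p' assume "p \<in> Obj M" "p' \<in> Obj M" "psh_restrict S p = psh_restrict S p'"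
    then show "p = p'" using ex[of p] ex[of p'] by auto
  qed
qed

text \<open>
  Restriction is a one-sided inverse of \<open>L\<^sub>T\<close> in any case; injectivity makes it two-sided.
\<close>

lemma E2_isomorphism:
  assumes inj: "inj_on (psh_restrict S) (Obj M)" and sub: "Obj M \<subseteq> Obj T.M"
  shows "isomorphism Q ST.M M (E2 Q A B \<phi> S T)"
proof -
  let ?E = "\<lambda>q \<in> Obj ST.M. T.lower (ST.upper q)" and ?R = "\<lambda>p \<in> Obj T.M. psh_restrict S p"
  have Obj_eq: "Obj M = Obj T.M" using sub M_cod_subset[OF T_subset] by auto
  then have M_eq: "M = T.M" by (simp add: M_cat_def subcat_def)
  have ER: "T.lower (ST.upper (psh_restrict S p)) = p" if p: "p \<in> Obj T.M" for p
    using inj_onD[OF inj restrict_extend_T[OF restrict_in_ST[OF p]]]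
      extend_in_T[OF restrict_in_ST[OF p]] p Obj_eq by simp
  have "?E = M_I_B' Q A B \<phi> S T"
    using T.M_I_B_eq[OF S_subset] T_dom_dist M_I_B'_eq by simp
  then have "qfunctor Q ST.M T.M ?E" "qfunctor Q T.M ST.M ?R"
    using adjunction_ST_T by (simp_all add: adjunction_def)
  moreover have "compose (Obj ST.M) ?R ?E = id_functor ST.M"
    using extend_in_T restrict_extend_T by (auto simp: compose_def id_functor_def)
  moreover have "compose (Obj T.M) ?E ?R = id_functor T.M"
    using restrict_in_ST ER by (auto simp: compose_def id_functor_def)
  ultimately show ?thesis unfolding E2_eq M_eq isomorphism_def by blast
qed

end

theorem theorem4p2p3:
  fixes Q :: "('o, 'm) quantaloid"
    and A :: "('a, 'o, 'm) qcat"
    and B :: "('b, 'o, 'm) qcat"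
    and \<phi> :: "'a \<times> 'b \<Rightarrow> 'm"
    and S :: "'a set"
    and T :: "'b set"
  assumes "quantaloid Q"
    and "qcategory Q A" and "qcategory Q B"
    and "distributor Q A B \<phi>"
    and "S \<subseteq> Obj A" and "T \<subseteq> Obj B"
  shows "is_reduct Q A B \<phi> S T \<longleftrightarrow>
    reducible_dom Q A B \<phi> (Obj A - S) \<and> reducible_cod Q A B \<phi> (Obj B - T)"
proof -
  interpret subcategories Q A B \<phi> S T
    using assms by (simp add: subcategories_def subcategories_axioms_def qdistributor_def
        qdistributor_axioms_def)
  have "is_reduct Q A B \<phi> S T \<longleftrightarrow> inj_on (psh_restrict S) (Obj M) \<and> Obj M \<subseteq> Obj T.M"
  proof
    assume "is_reduct Q A B \<phi> S T"
    then consider "isomorphism Q M ST.M (R1 Q A B \<phi> S T)" | "isomorphism Q M ST.M (R2 Q A B \<phi> S T)"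
      | "isomorphism Q ST.M M (E1 Q A B \<phi> S T)" | "isomorphism Q ST.M M (E2 Q A B \<phi> S T)"
      by (auto simp: is_reduct_def Let_def)
    then show "inj_on (psh_restrict S) (Obj M) \<and> Obj M \<subseteq> Obj T.M"
    proof cases
      case 1 then show ?thesis
        using reducible_if_R1_inj bij_betw_imp_inj_on[OF isomorphism_bij_betw] by blast
    next
      case 2 then show ?thesis
        using reducible_if_R2_inj bij_betw_imp_inj_on[OF isomorphism_bij_betw] by blast
    next
      case 3 then show ?thesis
        using reducible_if_E1_surj bij_betw_imp_surj_on[OF isomorphism_bij_betw] by blast
    next
      case 4 then show ?thesis
        using reducible_if_E2_surj bij_betw_imp_surj_on[OF isomorphism_bij_betw] by blast
    qed
  next
    assume "inj_on (psh_restrict S) (Obj M) \<and> Obj M \<subseteq> Obj T.M"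
    then show "is_reduct Q A B \<phi> S T"
      using E2_isomorphism by (simp add: is_reduct_def Let_def)
  qed
  then show ?thesis
    using reducible_dom_iff_inj[OF S_subset] reducible_cod_iff_subset[OF T_subset] by simp
qed

end
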